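(* Let $(X_n)_{n\in\mathbb Z}$ be a stationary GARCH(1,1) process (as defined in the context) with continuous marginal distribution function $F_X$, let $\mathfrak p\in(1,2)$, and let $(Y_n)_{n\ge1}$ be i.i.d. with characteristic function $\exp(-|t|^{\mathfrak p})$, independent of $(X_n)$. Let $h(x)=x^2-\mathbb E X_1^2$ and assume $h\circ F_X^{-1}\in L^r([0,1])$ for some $r>\mathfrak p$. Set $$I_n(h)=\frac1{n^{1/\mathfrak p}}\sum_{i=1}^n h(X_i)Y_i,\qquad I(h\circ F_X^{-1})=\int_0^1 h(F_X^{-1}(u))\,dM(u),$$ where $M$ is a $\mathfrak p$-stable motion on $[0,1]$ and the integral is the stable integral. Then (i) the law of $I_n(h)$ converges weakly to the law of $I(h\circ F_X^{-1})$, and (ii) for every $x\in\mathbb R$, $$\lim_{N\to\infty}\frac1{\log N}\sum_{n=1}^N\frac1n\mathbb 1_{\{I_n(h)\le x\}}=\mathbb P\big(I(h\circ F_X^{-1})\le x\big)\quad\text{almost surely.}$$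
   Context: A stationary GARCH(1,1) process: there is an i.i.d. real sequence $(\xi_n)_{n\in\mathbb Z}$ with $\mathbb E\xi_0=0$, $\mathbb E\xi_0^2=1$, constants $a_0>0$, $a_1>0$, $b_1\ge0$ with $-\infty<\mathbb E\log(a_1\xi_0^2+b_1)<0$, and a positive process $(\sigma_n)_{n\in\mathbb Z}$ such that $X_n=\sigma_n\xi_n$ and $\sigma_n^2=a_0+a_1X_{n-1}^2+b_1\sigma_{n-1}^2$ for all $n$ (stationary and ergodic solution). A $\mathfrak p$-stable motion with respect to a filtration $(\mathcal F_t)$ is an adapted process $M$ with paths in $D([0,\infty))$ and $\mathbb E[\exp(iy(M(t)-M(s)))\mid\mathcal F_s]=\exp(-(t-s)|y|^{\mathfrak p})$ for $0\le s<t$, $y\in\mathbb R$. For deterministic $g\in L^{\mathfrak p}([0,1])$ the stable integral $\int_0^1 g\,dM$ is the extension (Rosinski–Woyczynski) of the map defined on step functions $g=\sum_k c_k\mathbb 1_{(t_k,t_{k+1}]}$ by $\sum_k c_k(M(t_{k+1})-M(t_k))$; in particular it is a symmetric $\mathfrak p$-stable variable with characteristic function $\exp(-|y|^{\mathfrak p}\int_0^1|g|^{\mathfrak p})$. *)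

theory Defs
  imports "HOL-Probability.Probability"
begin

definition stationary_seq :: "'a measure \<Rightarrow> (int \<Rightarrow> 'a \<Rightarrow> 'b::topological_space) \<Rightarrow> bool" where
  "stationary_seq M Z \<longleftrightarrow>
     (\<forall>k::int. distr M (PiM UNIV (\<lambda>_. borel)) (\<lambda>\<omega> n. Z (n + k) \<omega>)
              = distr M (PiM UNIV (\<lambda>_. borel)) (\<lambda>\<omega> n. Z n \<omega>))"

definition ergodic_seq :: "'a measure \<Rightarrow> (int \<Rightarrow> 'a \<Rightarrow> 'b::topological_space) \<Rightarrow> bool" where
  "ergodic_seq M Z \<longleftrightarrow>
     (let P = distr M (PiM UNIV (\<lambda>_. borel)) (\<lambda>\<omega> n. Z n \<omega>) in
      \<forall>A \<in> sets P. (\<lambda>f n. f (n + 1)) -` A \<inter> space P = A \<longrightarrow>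
                   measure P A = 0 \<or> measure P A = 1)"

definition garch11 :: "'a measure \<Rightarrow> (int \<Rightarrow> 'a \<Rightarrow> real) \<Rightarrow> (int \<Rightarrow> 'a \<Rightarrow> real)
      \<Rightarrow> (int \<Rightarrow> 'a \<Rightarrow> real) \<Rightarrow> real \<Rightarrow> real \<Rightarrow> real \<Rightarrow> bool" where
  "garch11 M X \<sigma> \<xi> a0 a1 b1 \<longleftrightarrow>
     prob_space M \<and>
     (\<forall>n. \<xi> n \<in> borel_measurable M) \<and> (\<forall>n. \<sigma> n \<in> borel_measurable M) \<and>
     prob_space.indep_vars M (\<lambda>_. borel) \<xi> UNIV \<and>
     (\<forall>n. distr M borel (\<xi> n) = distr M borel (\<xi> 0)) \<and>
     integrable M (\<lambda>\<omega>. (\<xi> 0 \<omega>)\<^sup>2) \<and>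
     (\<integral>\<omega>. \<xi> 0 \<omega> \<partial>M) = 0 \<and> (\<integral>\<omega>. (\<xi> 0 \<omega>)\<^sup>2 \<partial>M) = 1 \<and>
     a0 > 0 \<and> a1 > 0 \<and> b1 \<ge> 0 \<and>
     (AE \<omega> in M. a1 * (\<xi> 0 \<omega>)\<^sup>2 + b1 > 0) \<and>
     integrable M (\<lambda>\<omega>. ln (a1 * (\<xi> 0 \<omega>)\<^sup>2 + b1)) \<and>
     (\<integral>\<omega>. ln (a1 * (\<xi> 0 \<omega>)\<^sup>2 + b1) \<partial>M) < 0 \<and>
     (\<forall>n. \<forall>\<omega>\<in>space M. \<sigma> n \<omega> > 0) \<and>
     (\<forall>n. \<forall>\<omega>\<in>space M. X n \<omega> = \<sigma> n \<omega> * \<xi> n \<omega>) \<and>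
     (\<forall>n. \<forall>\<omega>\<in>space M. (\<sigma> n \<omega>)\<^sup>2 = a0 + a1 * (X (n - 1) \<omega>)\<^sup>2 + b1 * (\<sigma> (n - 1) \<omega>)\<^sup>2) \<and>
     stationary_seq M (\<lambda>n \<omega>. (\<sigma> n \<omega>, \<xi> n \<omega>)) \<and>
     ergodic_seq M (\<lambda>n \<omega>. (\<sigma> n \<omega>, \<xi> n \<omega>))"

definition quantile :: "(real \<Rightarrow> real) \<Rightarrow> real \<Rightarrow> real" where
  "quantile F u = Inf {x. u \<le> F x}"

definition cadlag :: "(real \<Rightarrow> real) \<Rightarrow> bool" where
  "cadlag f \<longleftrightarrow> (\<forall>t\<ge>0. continuous (at_right t) f) \<and>
                 (\<forall>t>0. \<exists>l. (f \<longlongrightarrow> l) (at_left t))"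

text \<open>A p-stable motion with respect to the filtration F on the probability space N.
  The conditional characteristic-function condition is written out via the defining
  property of conditional expectation: integrating over any A in F s.\<close>
definition stable_motion :: "real \<Rightarrow> 'b measure \<Rightarrow> (real \<Rightarrow> 'b measure)
      \<Rightarrow> (real \<Rightarrow> 'b \<Rightarrow> real) \<Rightarrow> bool" where
  "stable_motion p N F Mo \<longleftrightarrow>
     prob_space N \<and>
     (\<forall>t\<ge>0. subalgebra N (F t)) \<and>
     (\<forall>s t. 0 \<le> s \<longrightarrow> s \<le> t \<longrightarrow> sets (F s) \<subseteq> sets (F t)) \<and>
     (\<forall>t\<ge>0. Mo t \<in> borel_measurable (F t)) \<and>
     (\<forall>\<omega>\<in>space N. cadlag (\<lambda>t. Mo t \<omega>)) \<and>
     (\<forall>s t y. 0 \<le> s \<longrightarrow> s < t \<longrightarrow> (\<forall>A\<in>sets (F s).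
        (CLINT \<omega>|N. indicator A \<omega> * iexp (y * (Mo t \<omega> - Mo s \<omega>)))
          = complex_of_real (measure N A * exp (- (t - s) * \<bar>y\<bar> powr p))))"

definition step_partition :: "(nat \<Rightarrow> real) \<Rightarrow> nat \<Rightarrow> bool" where
  "step_partition T m \<longleftrightarrow> 0 \<le> T 0 \<and> T m \<le> 1 \<and> (\<forall>k<m. T k < T (Suc k))"

definition step_fun :: "(nat \<Rightarrow> real) \<Rightarrow> (nat \<Rightarrow> real) \<Rightarrow> nat \<Rightarrow> real \<Rightarrow> real" where
  "step_fun T C m u = (\<Sum>k<m. C k * indicator {T k<..T (Suc k)} u)"

definition step_integral :: "(real \<Rightarrow> 'b \<Rightarrow> real) \<Rightarrow> (nat \<Rightarrow> real) \<Rightarrow> (nat \<Rightarrow> real) \<Rightarrow> nat \<Rightarrow> 'b \<Rightarrow> real" where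
  "step_integral Mo T C m \<omega> = (\<Sum>k<m. C k * (Mo (T (Suc k)) \<omega> - Mo (T k) \<omega>))"

text \<open>Z is the stable integral of g over [0,1] w.r.t. Mo: the (Rosinski--Woyczynski)
  continuous extension of the step-function map from L^p([0,1]) to random variables with
  convergence in probability.\<close>
definition stable_integral :: "real \<Rightarrow> 'b measure \<Rightarrow> (real \<Rightarrow> 'b \<Rightarrow> real) \<Rightarrow> (real \<Rightarrow> real)
      \<Rightarrow> ('b \<Rightarrow> real) \<Rightarrow> bool" where
  "stable_integral p N Mo g Z \<longleftrightarrow>
     Z \<in> borel_measurable N \<and>
     (\<forall>T C m. (\<forall>j. step_partition (T j) (m j)) \<longrightarrow>
        (\<lambda>j. LBINT u:{0..1}. \<bar>g u - step_fun (T j) (C j) (m j) u\<bar> powr p) \<longlonglongrightarrow> 0 \<longrightarrow>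
        (\<forall>\<epsilon>>0. (\<lambda>j. measure N {\<omega>\<in>space N.
              \<bar>step_integral Mo (T j) (C j) (m j) \<omega> - Z \<omega>\<bar> > \<epsilon>}) \<longlonglongrightarrow> 0))"

end

theory Submission
  imports Defs
begin

text \<open>
  Given \<open>X\<close>, the sum \<open>I\<^sub>n\<close> is symmetric stable with scale \<open>A\<^sub>n = (1 / n) \<Sum> \<bar>h (X\<^sub>i)\<bar> powr p\<close>, and
  \<open>A\<^sub>n\<close> tends almost surely to \<open>c = E \<bar>h (X\<^sub>1)\<bar> powr p = \<integral> \<bar>h \<circ> F\<^sup>-\<^sup>1\<bar> powr p\<close> by the ergodic theorem. So the
  characteristic function of \<open>I\<^sub>n\<close>, which is \<open>E exp (- \<bar>t\<bar> powr p * A\<^sub>n)\<close>, tends to that of the stable integral.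
  For the almost sure statement fix \<open>t\<close> and centre \<open>exp (i t I\<^sub>n)\<close> at its conditional mean
  \<open>exp (- \<bar>t\<bar> powr p * A\<^sub>n)\<close>: an exact computation with stable scales bounds the covariance of the \<open>n\<close>-th and
  \<open>m\<close>-th terms, \<open>n \<le> m\<close>, by a multiple of \<open>sqrt (n / m)\<close>, so their logarithmic means vanish almost surely: the second
  moments are summable along \<open>2 ^ j\<^sup>2\<close>, and the gaps are filled by interpolation. By Fubini, for almost every outcome the
  characteristic functions of the logarithmic empirical measures converge at almost every \<open>t\<close>, and
  this is enough for weak convergence. The limit law has an integrable characteristic function,
  hence no atoms, because the continuity of the marginal distribution forces \<open>c > 0\<close>.
\<close>

subsection \<open>Birkhoff's ergodic theorem\<close>

text \<open>The terms are centred at their conditional means, not at the limit, because the ergodic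
  theorem carries no rate: covariances around the limit could not be estimated. Given the weights,
  every linear combination of \<open>I\<^sub>n\<close> and \<open>I\<^sub>m\<close> is symmetric
  stable, so the covariance of the centred terms is the expectation of a difference of two explicit
  exponentials. Their exponents are linear in the averages, hence a first moment of the p-th powers
  suffices. The decay \<open>sqrt (n / m)\<close> comes from \<open>(n / m) powr (1 / p)\<close> and
  p < 2. It gives the logarithmic mean of length K a second moment of order 1 / log K, which is not
  summable over all K; this forces the sparse subsequence. The exceptional event depends on t, so
  Fubini delivers convergence only for almost every t, and Levy's continuity theorem becomes
  applicable through an increment inequality for characteristic functions. The definition of the
  stable integral speaks only of approximating step functions, so the law of \<open>Z\<close> rests
  on their density in the p-th mean.\<close>

primrec birkhoff_max :: "('a \<Rightarrow> 'a) \<Rightarrow> ('a \<Rightarrow> real) \<Rightarrow> nat \<Rightarrow> 'a \<Rightarrow> real" where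
  "birkhoff_max T f 0 x = 0"
| "birkhoff_max T f (Suc n) x = max 0 (f x + birkhoff_max T f n (T x))"

definition birkhoff_sum :: "('a \<Rightarrow> 'a) \<Rightarrow> ('a \<Rightarrow> real) \<Rightarrow> nat \<Rightarrow> 'a \<Rightarrow> real" where
  "birkhoff_sum T f n x = (\<Sum>i<n. f ((T ^^ i) x))"

lemma birkhoff_sum_Suc: "birkhoff_sum T f (Suc n) x = f x + birkhoff_sum T f n (T x)"
  by (simp add: birkhoff_sum_def sum.lessThan_Suc_shift funpow_swap1 del: sum.lessThan_Suc)

lemma birkhoff_max_nonneg: "0 \<le> birkhoff_max T f n x"
  by (cases n) auto

lemma birkhoff_max_mono: "birkhoff_max T f n x \<le> birkhoff_max T f (Suc n) x"
proof (induction n arbitrary: x)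
  case (Suc n)
  from Suc[of "T x"] show ?case
    unfolding birkhoff_max.simps(2)[of T f n] birkhoff_max.simps(2)[of T f "Suc n"] by linarith
qed simp

lemma birkhoff_sum_le_max: "birkhoff_sum T f n x \<le> birkhoff_max T f n x"
proof (induction n arbitrary: x)
  case (Suc n)
  from Suc[of "T x"] show ?case by (simp add: birkhoff_sum_Suc)
qed (simp add: birkhoff_sum_def)

lemma integrable_birkhoff_max:
  assumes T: "T \<in> measurable M M" "distr M M T = M" and f: "integrable M f"
  shows "integrable M (birkhoff_max T f n)"
proof (induction n)
  case (Suc n)
  have "integrable M (\<lambda>x. birkhoff_max T f n (T x))"
    using Suc T by (metis integrable_distr)
  then show ?case using f by simp
qed simp

text \<open>Garsia's argument. \<open>birkhoff_max T f n\<close> is the maximum of the Birkhoff sums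
  of lengths 0 to n, in recursive form. Where it is positive it is at most \<open>f x\<close> plus
  its value at \<open>T x\<close>; elsewhere it is 0, hence at most its value at \<open>T x\<close>.
  Integration cancels the two maxima by invariance, and dominated convergence along the increasing
  sets \<open>E n\<close> removes the bound on n.\<close>

lemma maximal_ergodic:
  assumes T: "T \<in> measurable M M" "distr M M T = M" and f: "integrable M f"
  shows "0 \<le> (\<integral>x. indicator {x\<in>space M. \<exists>n. 0 < birkhoff_max T f n x} x * f x \<partial>M)"
proof -
  define m where "m = birkhoff_max T f"
  have int_m: "integrable M (m n)" for n
    unfolding m_def by (rule integrable_birkhoff_max[OF T f])
  have int_mT: "integrable M (\<lambda>x. m n (T x))" for n
    using int_m T by (metis integrable_distr)
  have [measurable]: "m n \<in> borel_measurable M" "f \<in> borel_measurable M" for n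
    using int_m f by auto
  have eq: "(\<integral>x. m n (T x) \<partial>M) = (\<integral>x. m n x \<partial>M)" for n
    using integral_distr[OF T(1), of "m n"] T(2) by simp
  define E where "E n = {x\<in>space M. 0 < m n x}" for n
  have [measurable]: "E n \<in> sets M" for n unfolding E_def by measurable
  have int_E: "integrable M (\<lambda>x. indicator (E n) x * f x)" for n
    using integrable_mult_indicator[OF _ f, of "E n"] by simp
  have m_step: "m n x \<le> f x + m n (T x)" if "0 < m n x" for n x
  proof (cases n)
    case (Suc k)
    have "m n x = f x + m k (T x)" using that by (simp add: m_def Suc)
    moreover have "m k (T x) \<le> m n (T x)" unfolding m_def Suc by (rule birkhoff_max_mono)
    ultimately show ?thesis by simp
  qed (use that in \<open>simp add: m_def\<close>)
  have nonneg: "0 \<le> (\<integral>x. indicator (E n) x * f x \<partial>M)" for n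
  proof -
    have "(\<integral>x. m n x - m n (T x) \<partial>M) \<le> (\<integral>x. indicator (E n) x * f x \<partial>M)"
    proof (rule integral_mono)
      fix x assume x: "x \<in> space M"
      have "0 \<le> m n x" "0 \<le> m n (T x)" unfolding m_def by (rule birkhoff_max_nonneg)+
      then show "m n x - m n (T x) \<le> indicator (E n) x * f x"
        using m_step[of n x] x by (auto simp: E_def indicator_def)
    qed (use int_m int_mT int_E in auto)
    then show ?thesis using eq[of n] int_m[of n] int_mT[of n] by simp
  qed
  have inc: "incseq E"
    using birkhoff_max_mono[of T f]
    by (intro incseq_SucI) (auto simp: E_def m_def intro: less_le_trans simp del: birkhoff_max.simps)
  have "(\<lambda>n. \<integral>x. indicator (E n) x * f x \<partial>M) \<longlonglongrightarrow> (\<integral>x. indicator (\<Union>n. E n) x * f x \<partial>M)"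
  proof (rule integral_dominated_convergence[where w = "\<lambda>x. norm (f x)"])
    show "AE x in M. (\<lambda>n. indicator (E n) x * f x) \<longlonglongrightarrow> indicator (\<Union>n. E n) x * f x"
      by (intro AE_I2 tendsto_mult tendsto_const LIMSEQ_indicator_incseq inc)
    show "AE x in M. norm (indicator (E n) x * f x) \<le> norm (f x)" for n
      by (auto simp: indicator_def)
  qed (use f in auto)
  then have "0 \<le> (\<integral>x. indicator (\<Union>n. E n) x * f x \<partial>M)"
    by (rule LIMSEQ_le_const) (use nonneg in auto)
  moreover have "(\<Union>n. E n) = {x\<in>space M. \<exists>n. 0 < birkhoff_max T f n x}"
    by (auto simp: E_def m_def)
  ultimately show ?thesis by simp
qed

text \<open>The set where the Birkhoff sums are unbounded above is invariant; were it of full measure,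
  the maximal inequality would give a nonnegative mean.\<close>

lemma (in prob_space) birkhoff_sum_bdd_above:
  assumes T: "T \<in> measurable M M" "distr M M T = M" and f: "integrable M f"
    and erg: "\<And>A. A \<in> sets M \<Longrightarrow> T -` A \<inter> space M = A \<Longrightarrow> prob A = 0 \<or> prob A = 1"
    and neg: "expectation f < 0"
  shows "AE x in M. \<exists>K. \<forall>n. birkhoff_sum T f n x \<le> K"
proof -
  have [measurable]: "f \<in> borel_measurable M" "T \<in> measurable M M" using f T by auto
  have [measurable]: "birkhoff_sum T f n \<in> borel_measurable M" for n
    unfolding birkhoff_sum_def by measurable
  define D where "D = {x\<in>space M. \<forall>K::nat. \<exists>n. real K < birkhoff_sum T f n x}"
  have D[measurable]: "D \<in> sets M" unfolding D_def by measurable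
  have D_iff: "x \<in> D \<longleftrightarrow> x \<in> space M \<and> (\<forall>K. \<exists>n. K < birkhoff_sum T f n x)" for x
    unfolding D_def by simp (meson less_trans reals_Archimedean2)
  have "T -` D \<inter> space M = D"
  proof (intro set_eqI iffI)
    fix x assume "x \<in> T -` D \<inter> space M"
    then have x: "x \<in> space M" "\<And>K. \<exists>n. K < birkhoff_sum T f n (T x)" by (auto simp: D_iff)
    show "x \<in> D" unfolding D_iff
    proof (intro conjI allI x(1))
      fix K
      obtain n where "K - f x < birkhoff_sum T f n (T x)" using x(2) by blast
      then have "K < birkhoff_sum T f (Suc n) x" by (simp add: birkhoff_sum_Suc)
      then show "\<exists>n. K < birkhoff_sum T f n x" by blast
    qed
  next
    fix x assume "x \<in> D"
    then have x: "x \<in> space M" "\<And>K. \<exists>n. K < birkhoff_sum T f n x" by (auto simp: D_iff)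
    have "T x \<in> D" unfolding D_iff
    proof (intro conjI allI)
      show "T x \<in> space M" using measurable_space[OF T(1) x(1)] .
      fix K
      \<comment> \<open>The \<open>max 0\<close> rules out the empty sum n = 0, so that a first
        summand can be split off.\<close>
      obtain n where n: "max 0 (K + f x) < birkhoff_sum T f n x" using x(2) by blast
      then obtain k where "n = Suc k" by (cases n) (auto simp: birkhoff_sum_def)
      with n have "K < birkhoff_sum T f k (T x)" by (simp add: birkhoff_sum_Suc)
      then show "\<exists>n. K < birkhoff_sum T f n (T x)" by blast
    qed
    with x(1) show "x \<in> T -` D \<inter> space M" by auto
  qed
  with erg[OF D] consider "prob D = 0" | "prob D = 1" by blast
  then have "prob D = 0"
  proof cases
    case 2
    then have "AE x in M. x \<in> D" by (simp add: prob_eq_1)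
    then have ae: "AE x in M. \<exists>n. 0 < birkhoff_max T f n x"
    proof (rule AE_mp, intro AE_I2 impI)
      fix x assume "x \<in> D"
      then obtain n where "0 < birkhoff_sum T f n x" by (auto simp: D_iff)
      then show "\<exists>n. 0 < birkhoff_max T f n x" using birkhoff_sum_le_max[of T f n x] by (meson less_le_trans)
    qed
    have "(\<integral>x. indicator {x\<in>space M. \<exists>n. 0 < birkhoff_max T f n x} x * f x \<partial>M) = expectation f"
    proof (rule integral_cong_AE)
      have [measurable]: "birkhoff_max T f n \<in> borel_measurable M" for n
        using integrable_birkhoff_max[OF T f] by auto
      show "(\<lambda>x. indicator {x\<in>space M. \<exists>n. 0 < birkhoff_max T f n x} x * f x) \<in> borel_measurable M"
        by measurable
      show "AE x in M. indicator {x\<in>space M. \<exists>n. 0 < birkhoff_max T f n x} x * f x = f x"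
        using ae by (auto simp: indicator_def)
    qed auto
    with maximal_ergodic[OF T f] neg show ?thesis by simp
  qed
  then have "AE x in M. x \<notin> D" by (simp add: prob_eq_0)
  then show ?thesis
    by (rule AE_mp) (auto simp: D_iff not_less)
qed

text \<open>Subtracting \<open>expectation f + 1 / (k + 1)\<close> makes the mean negative, so the
  shifted sums are bounded above and the bound vanishes after division by n. Only countably many k
  occur, so their null sets unite to one.\<close>

lemma (in prob_space) birkhoff_average_upper:
  assumes T: "T \<in> measurable M M" "distr M M T = M" and f: "integrable M f"
    and erg: "\<And>A. A \<in> sets M \<Longrightarrow> T -` A \<inter> space M = A \<Longrightarrow> prob A = 0 \<or> prob A = 1"
  shows "AE x in M. \<forall>e>0. eventually (\<lambda>n. birkhoff_sum T f n x / real n < expectation f + e) sequentially"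
proof -
  have "AE x in M. \<forall>k. \<exists>K. \<forall>n. birkhoff_sum T (\<lambda>x. f x - (expectation f + 1 / real (Suc k))) n x \<le> K"
    unfolding AE_all_countable
    by (intro allI birkhoff_sum_bdd_above[OF T _ erg])
       (use f in \<open>auto simp: prob_space\<close>)
  then show ?thesis
  proof (rule AE_mp, intro AE_I2 impI allI)
    fix x and e :: real
    assume H: "\<forall>k. \<exists>K. \<forall>n. birkhoff_sum T (\<lambda>x. f x - (expectation f + 1 / real (Suc k))) n x \<le> K"
      and e: "0 < e"
    obtain k where k: "1 / real (Suc k) < e / 2" using nat_approx_posE[of "e/2"] e by auto
    from H obtain K where K: "\<And>n. birkhoff_sum T (\<lambda>x. f x - (expectation f + 1 / real (Suc k))) n x \<le> K" by blast
    have *: "birkhoff_sum T f n x \<le> K + real n * (expectation f + 1 / real (Suc k))" for n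
      using K[of n] by (simp add: birkhoff_sum_def sum_subtractf)
    have "(\<lambda>n. K / real n) \<longlonglongrightarrow> 0" by (rule lim_const_over_n)
    then have "eventually (\<lambda>n. K / real n < e / 2) sequentially"
      using e by (intro order_tendstoD) auto
    moreover have "eventually (\<lambda>n::nat. n > 0) sequentially" by (rule eventually_gt_at_top)
    ultimately show "eventually (\<lambda>n. birkhoff_sum T f n x / real n < expectation f + e) sequentially"
    proof eventually_elim
      case (elim n)
      have "birkhoff_sum T f n x / real n \<le> (K + real n * (expectation f + 1 / real (Suc k))) / real n"
        using * by (intro divide_right_mono) auto
      also have "\<dots> = K / real n + (expectation f + 1 / real (Suc k))"
        using elim by (simp add: field_simps)
      finally show ?case using elim k by linarith
    qed
  qed
qed

text \<open>The lower bound is the upper bound for \<open>- f\<close>.\<close>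

theorem (in prob_space) birkhoff_ergodic:
  assumes T: "T \<in> measurable M M" "distr M M T = M" and f: "integrable M f"
    and erg: "\<And>A. A \<in> sets M \<Longrightarrow> T -` A \<inter> space M = A \<Longrightarrow> prob A = 0 \<or> prob A = 1"
  shows "AE x in M. (\<lambda>n. birkhoff_sum T f n x / real n) \<longlonglongrightarrow> expectation f"
proof -
  have neg: "integrable M (\<lambda>x. - f x)" using f by simp
  have "AE x in M. \<forall>e>0. eventually (\<lambda>n. birkhoff_sum T f n x / real n < expectation f + e) sequentially"
    by (rule birkhoff_average_upper[OF T f erg])
  moreover have "AE x in M. \<forall>e>0. eventually (\<lambda>n. birkhoff_sum T (\<lambda>x. - f x) n x / real n
      < expectation (\<lambda>x. - f x) + e) sequentially"
    by (rule birkhoff_average_upper[OF T neg erg])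
  ultimately show ?thesis
  proof eventually_elim
    case (elim x)
    have "birkhoff_sum T (\<lambda>x. - f x) n x = - birkhoff_sum T f n x" for n
      by (simp add: birkhoff_sum_def sum_negf)
    with elim(2) have lower: "\<forall>e>0. eventually (\<lambda>n. expectation f - e < birkhoff_sum T f n x / real n) sequentially"
      by (auto simp: algebra_simps elim!: eventually_mono)
    show ?case
    proof (rule order_tendstoI)
      fix a assume "a < expectation f"
      with lower[rule_format, of "expectation f - a"]
      show "eventually (\<lambda>n. a < birkhoff_sum T f n x / real n) sequentially" by simp
    next
      fix a assume "expectation f < a"
      with elim(1)[rule_format, of "a - expectation f"]
      show "eventually (\<lambda>n. birkhoff_sum T f n x / real n < a) sequentially" by simp
    qed
  qed
qed

subsection \<open>Stable integrals\<close>

lemma cmod_iexp_diff_le: "cmod (iexp a - iexp b) \<le> \<bar>a - b\<bar>"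
proof -
  have "iexp a - iexp b = iexp b * (iexp (a - b) - 1)"
    by (simp add: algebra_simps flip: exp_add)
  then have "cmod (iexp a - iexp b) = cmod (iexp (a - b) - 1)"
    by (simp add: norm_mult)
  also have "\<dots> \<le> \<bar>a - b\<bar>"
    using iexp_approx1[of "a - b" 0] by simp
  finally show ?thesis .
qed

lemma cmod_iexp_diff_le_2: "cmod (iexp a - iexp b) \<le> 2"
  using norm_triangle_ineq4[of "iexp a" "iexp b"] by simp

text \<open>Where \<open>S j\<close> and \<open>Z\<close> are within e of each other the Lipschitz
  bound applies; on the remaining event, of small probability, the trivial bound 2.\<close>

lemma (in prob_space) integral_iexp_in_probability:
  assumes [measurable]: "\<And>j. S j \<in> borel_measurable M" "Z \<in> borel_measurable M"
    and conv: "\<And>e. e > 0 \<Longrightarrow> (\<lambda>j. prob {\<omega>\<in>space M. \<bar>S j \<omega> - Z \<omega>\<bar> > e}) \<longlonglongrightarrow> 0"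
  shows "(\<lambda>j. CLINT \<omega>|M. iexp (y * S j \<omega>)) \<longlonglongrightarrow> (CLINT \<omega>|M. iexp (y * Z \<omega>))"
proof (rule LIMSEQ_I)
  fix r :: real assume r: "0 < r"
  \<comment> \<open>The \<open>+ 1\<close> covers y = 0 and makes
    \<open>\<bar>y\<bar> * e < r / 2\<close> strict.\<close>
  define e where "e = r / (2 * (\<bar>y\<bar> + 1))"
  have e: "0 < e" "\<bar>y\<bar> * e < r / 2"
    using r by (auto simp: e_def field_simps)
  have "eventually (\<lambda>j. prob {\<omega>\<in>space M. \<bar>S j \<omega> - Z \<omega>\<bar> > e} < r / 4) sequentially"
    using conv[OF e(1)] r by (intro order_tendstoD) auto
  then obtain n0 where n0: "\<And>j. j \<ge> n0 \<Longrightarrow> prob {\<omega>\<in>space M. \<bar>S j \<omega> - Z \<omega>\<bar> > e} < r / 4"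
    by (auto simp: eventually_sequentially)
  show "\<exists>no. \<forall>n\<ge>no. norm ((CLINT \<omega>|M. iexp (y * S n \<omega>)) - (CLINT \<omega>|M. iexp (y * Z \<omega>))) < r"
  proof (intro exI[of _ n0] allI impI)
    fix n assume n: "n0 \<le> n"
    let ?A = "{\<omega>\<in>space M. \<bar>S n \<omega> - Z \<omega>\<bar> > e}"
    have A[measurable]: "?A \<in> events" by measurable
    have iA: "integrable M (indicator ?A :: _ \<Rightarrow> real)"
      by (rule integrable_real_indicator[OF A]) (simp add: less_top[symmetric])
    have int: "integrable M (\<lambda>\<omega>. iexp (y * S n \<omega>))" "integrable M (\<lambda>\<omega>. iexp (y * Z \<omega>))"
      by (rule integrable_iexp; simp)+
    have "norm ((CLINT \<omega>|M. iexp (y * S n \<omega>)) - (CLINT \<omega>|M. iexp (y * Z \<omega>)))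
        = norm (CLINT \<omega>|M. iexp (y * S n \<omega>) - iexp (y * Z \<omega>))"
      using int by simp
    also have "\<dots> \<le> (\<integral>\<omega>. norm (iexp (y * S n \<omega>) - iexp (y * Z \<omega>)) \<partial>M)"
      by (rule integral_norm_bound)
    also have "\<dots> \<le> (\<integral>\<omega>. \<bar>y\<bar> * e + 2 * indicator ?A \<omega> \<partial>M)"
    proof (rule integral_mono)
      fix \<omega> assume w: "\<omega> \<in> space M"
      show "norm (iexp (y * S n \<omega>) - iexp (y * Z \<omega>)) \<le> \<bar>y\<bar> * e + 2 * indicator ?A \<omega>"
      proof (cases "\<omega> \<in> ?A")
        case True
        have "0 \<le> \<bar>y\<bar> * e" using e(1) by simp
        with True cmod_iexp_diff_le_2[of "y * S n \<omega>" "y * Z \<omega>"] show ?thesis by (simp del: of_real_mult)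
      next
        case False
        then have "\<bar>y\<bar> * \<bar>S n \<omega> - Z \<omega>\<bar> \<le> \<bar>y\<bar> * e" using w by (intro mult_left_mono) auto
        then show ?thesis
          using cmod_iexp_diff_le[of "y * S n \<omega>" "y * Z \<omega>"] False
          by (simp add: abs_mult flip: right_diff_distrib del: of_real_mult)
      qed
    next
      show "integrable M (\<lambda>\<omega>. cmod (iexp (y * S n \<omega>) - iexp (y * Z \<omega>)))"
        using int by (intro integrable_norm Bochner_Integration.integrable_diff)
    qed (use iA in simp)
    also have "\<dots> = \<bar>y\<bar> * e + 2 * prob ?A"
      using iA by (simp add: prob_space)
    also have "\<dots> < r" using e(2) n0[OF n] by linarith
    finally show "norm ((CLINT \<omega>|M. iexp (y * S n \<omega>)) - (CLINT \<omega>|M. iexp (y * Z \<omega>))) < r" .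
  qed
qed

text \<open>The definition of a stable motion tests increments only against indicators of past
  events. Linearity and dominated convergence extend this to integrable \<open>W\<close>, which is
  independence of the increment from the past in the form needed to split a factor off a
  characteristic function.\<close>

lemma stable_motion_increment:
  assumes Mo: "stable_motion p N F Mo" and st: "0 \<le> s" "s < t"
    and W: "W \<in> borel_measurable (F s)" "integrable N W"
  shows "(CLINT \<omega>|N. W \<omega> * iexp (y * (Mo t \<omega> - Mo s \<omega>)))
    = (CLINT \<omega>|N. W \<omega>) * complex_of_real (exp (- (t - s) * \<bar>y\<bar> powr p))"
proof -
  interpret N: prob_space N using Mo by (simp add: stable_motion_def)
  have sub: "subalgebra N (F s)" "subalgebra N (F t)" using Mo st by (auto simp: stable_motion_def)
  have "Mo t \<in> borel_measurable (F t)" "Mo s \<in> borel_measurable (F s)"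
    using Mo st by (auto simp: stable_motion_def)
  then have [measurable]: "Mo t \<in> borel_measurable N" "Mo s \<in> borel_measurable N"
    using sub measurable_from_subalg by blast+
  define e where "e \<omega> = iexp (y * (Mo t \<omega> - Mo s \<omega>))" for \<omega>
  define c where "c = complex_of_real (exp (- (t - s) * \<bar>y\<bar> powr p))"
  have [measurable]: "e \<in> borel_measurable N" unfolding e_def by measurable
  have e1: "cmod (e \<omega>) = 1" for \<omega> by (simp add: e_def del: of_real_mult)
  have int_e: "integrable N (\<lambda>\<omega>. f \<omega> * e \<omega>)" if f: "integrable N f" for f
  proof -
    have [measurable]: "f \<in> borel_measurable N" using f by auto
    show ?thesis by (rule Bochner_Integration.integrable_bound[OF f]) (auto simp: norm_mult e1)
  qed
  \<comment> \<open>The induction over integrable functions runs in the restricted measure, so that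
    its base sets lie in \<open>F s\<close> and the defining identity applies to them.\<close>
  have "integrable (restr_to_subalg N (F s)) W" by (rule integrable_in_subalg[OF sub(1) W])
  then have "(CLINT \<omega>|N. W \<omega> * e \<omega>) = (CLINT \<omega>|N. W \<omega>) * c"
  proof (induction rule: integrable_induct)
    case (base A d)
    then have A: "A \<in> sets (F s)" by (simp add: sets_restr_to_subalg[OF sub(1)])
    then have [measurable]: "A \<in> sets N" using sub(1) by (auto simp: subalgebra_def)
    have "(CLINT \<omega>|N. indicator A \<omega> * e \<omega>) = measure N A * c"
      using Mo st A unfolding stable_motion_def e_def c_def by simp
    moreover have "(CLINT \<omega>|N. (indicator A \<omega> *\<^sub>R d) * e \<omega>) = d * (CLINT \<omega>|N. indicator A \<omega> * e \<omega>)"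
    proof -
      have "(indicator A \<omega> *\<^sub>R d) * e \<omega> = d * (indicator A \<omega> * e \<omega>)" for \<omega>
        by (auto simp: indicator_def)
      then show ?thesis by (simp only: integral_mult_right_zero)
    qed
    ultimately show ?case
      by (simp add: scaleR_conv_of_real)
  next
    case (add f g)
    then have "integrable N f" "integrable N g" using integrable_from_subalg[OF sub(1)] by auto
    with add int_e show ?case by (simp add: distrib_right)
  next
    case (lim f u)
    have f: "integrable N f" "\<And>i. integrable N (u i)"
      using lim(1,4) by (blast intro: integrable_from_subalg[OF sub(1)])+
    then have [measurable]: "f \<in> borel_measurable N" "\<And>i. u i \<in> borel_measurable N" by auto
    have sp: "space (restr_to_subalg N (F s)) = space N" by (simp add: space_restr_to_subalg)
    have "(\<lambda>i. CLINT \<omega>|N. u i \<omega> * e \<omega>) \<longlonglongrightarrow> (CLINT \<omega>|N. f \<omega> * e \<omega>)"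
    proof (rule integral_dominated_convergence[where w = "\<lambda>\<omega>. 2 * cmod (f \<omega>)"])
      show "AE x in N. (\<lambda>i. u i x * e x) \<longlonglongrightarrow> f x * e x"
        using lim(2) by (intro AE_I2 tendsto_mult tendsto_const) (auto simp: sp)
      show "AE x in N. cmod (u i x * e x) \<le> 2 * cmod (f x)" for i
        using lim(3)  by (auto simp: norm_mult e1 sp)
    qed (use f in auto)
    moreover have "(\<lambda>i. CLINT \<omega>|N. u i \<omega>) \<longlonglongrightarrow> (CLINT \<omega>|N. f \<omega>)"
    proof (rule integral_dominated_convergence[where w = "\<lambda>\<omega>. 2 * cmod (f \<omega>)"])
      show "AE x in N. (\<lambda>i. u i x) \<longlonglongrightarrow> f x"
        using lim(2) by (auto simp: sp)
      show "AE x in N. cmod (u i x) \<le> 2 * cmod (f x)" for i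
        using lim(3)  by (auto simp: sp)
    qed (use f in auto)
    then have "(\<lambda>i. (CLINT \<omega>|N. u i \<omega>) * c) \<longlonglongrightarrow> (CLINT \<omega>|N. f \<omega>) * c"
      by (intro tendsto_mult tendsto_const)
    ultimately show ?case using lim(5) LIMSEQ_unique by simp
  qed
  then show ?thesis by (simp add: e_def c_def)
qed

lemma step_partition_mono:
  assumes "step_partition T m" "i \<le> j" "j \<le> m"
  shows "T i \<le> T j"
  using assms(2,3)
proof (induction rule: dec_induct)
  case (step n)
  then have "T n < T (Suc n)" using assms(1) by (auto simp: step_partition_def)
  with step show ?case by simp
qed simp

text \<open>Induction on the number of intervals: the first n increments are measurable with respect
  to \<open>F (T n)\<close>, so the next one contributes a factor.\<close>

lemma char_step_integral:
  assumes Mo: "stable_motion p N F Mo" and T: "step_partition T m"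
  shows "(CLINT \<omega>|N. iexp (y * step_integral Mo T C m \<omega>))
    = complex_of_real (exp (- (\<bar>y\<bar> powr p * (\<Sum>k<m. \<bar>C k\<bar> powr p * (T (Suc k) - T k)))))"
proof -
  interpret N: prob_space N using Mo by (simp add: stable_motion_def)
  have T0: "0 \<le> T k" if "k \<le> m" for k
    using step_partition_mono[OF T, of 0 k] that T by (auto simp: step_partition_def)
  have meas: "Mo (T j) \<in> borel_measurable (F (T i))" if "j \<le> i" "i \<le> m" for i j
  proof -
    have le: "0 \<le> T j" "T j \<le> T i" "0 \<le> T i" using T0 step_partition_mono[OF T] that by auto
    then have "Mo (T j) \<in> borel_measurable (F (T j))" "sets (F (T j)) \<subseteq> sets (F (T i))"
      "subalgebra N (F (T j))" "subalgebra N (F (T i))"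
      using Mo unfolding stable_motion_def by blast+
    then show ?thesis
      by (auto simp: measurable_def subalgebra_def)
  qed
  have "n \<le> m \<Longrightarrow> (CLINT \<omega>|N. iexp (y * step_integral Mo T C n \<omega>))
    = complex_of_real (exp (- (\<bar>y\<bar> powr p * (\<Sum>k<n. \<bar>C k\<bar> powr p * (T (Suc k) - T k)))))" for n
  proof (induction n)
    case 0
    show ?case by (simp add: step_integral_def N.prob_space del: of_real_mult)
  next
    case (Suc n)
    define W where "W \<omega> = iexp (y * step_integral Mo T C n \<omega>)" for \<omega>
    have [measurable]: "step_integral Mo T C n \<in> borel_measurable (F (T n))"
      unfolding step_integral_def
      by (intro borel_measurable_sum borel_measurable_times borel_measurable_const borel_measurable_diff meas)
         (use Suc in auto)
    have W: "W \<in> borel_measurable (F (T n))" unfolding W_def by measurable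
    have "subalgebra N (F (T n))" using Mo T0[of n] Suc by (auto simp: stable_motion_def)
    then have W': "W \<in> borel_measurable N" using W measurable_from_subalg by blast
    have "integrable N W"
      by (rule N.integrable_const_bound[where B = 1]) (use W' in \<open>auto simp: W_def simp del: of_real_mult\<close>)
    from stable_motion_increment[OF Mo T0 _ W this, of "T (Suc n)" "y * C n"] Suc.prems T
    have "(CLINT \<omega>|N. W \<omega> * iexp (y * C n * (Mo (T (Suc n)) \<omega> - Mo (T n) \<omega>)))
      = (CLINT \<omega>|N. W \<omega>) * complex_of_real (exp (- (T (Suc n) - T n) * \<bar>y * C n\<bar> powr p))"
      by (auto simp: step_partition_def)
    moreover have "W \<omega> * iexp (y * C n * (Mo (T (Suc n)) \<omega> - Mo (T n) \<omega>))
      = iexp (y * step_integral Mo T C (Suc n) \<omega>)" for \<omega>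
      by (simp add: W_def step_integral_def algebra_simps flip: exp_add)
    ultimately have "(CLINT \<omega>|N. iexp (y * step_integral Mo T C (Suc n) \<omega>))
      = (CLINT \<omega>|N. W \<omega>) * complex_of_real (exp (- (T (Suc n) - T n) * \<bar>y * C n\<bar> powr p))"
      by simp
    also have "(CLINT \<omega>|N. W \<omega>)
      = complex_of_real (exp (- (\<bar>y\<bar> powr p * (\<Sum>k<n. \<bar>C k\<bar> powr p * (T (Suc k) - T k)))))"
      using Suc by (simp add: W_def)
    also have "\<dots> * complex_of_real (exp (- (T (Suc n) - T n) * \<bar>y * C n\<bar> powr p))
      = complex_of_real (exp (- (\<bar>y\<bar> powr p * (\<Sum>k<Suc n. \<bar>C k\<bar> powr p * (T (Suc k) - T k)))))"
      by (subst of_real_mult[symmetric], subst exp_add[symmetric])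
         (simp add: abs_mult powr_mult algebra_simps)
    finally show ?case .
  qed
  then show ?thesis by simp
qed

section \<open>Step functions and their density in the p-th mean\<close>

lemma step_fun_apply:
  assumes T: "step_partition T m" and k: "k < m" and u: "u \<in> {T k<..T (Suc k)}"
  shows "step_fun T C m u = C k"
proof -
  have "u \<notin> {T j<..T (Suc j)}" if "j < m" "j \<noteq> k" for j
    using step_partition_mono[OF T, of "Suc j" k] step_partition_mono[OF T, of "Suc k" j] that k u
    by (cases "j < k") auto
  then have "step_fun T C m u = (\<Sum>j<m. if j = k then C k else 0)"
    unfolding step_fun_def using u by (intro sum.cong) auto
  then show ?thesis using k by simp
qed

lemma step_fun_outside:
  assumes "\<And>k. k < m \<Longrightarrow> u \<notin> {T k<..T (Suc k)}"
  shows "step_fun T C m u = 0"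
  using assms unfolding step_fun_def by (intro sum.neutral) auto

text \<open>The half-open intervals are disjoint, so at most one summand is active at each point,
  and \<open>\<phi> 0 = 0\<close> settles the points outside all of them. Truncations and p-th
  powers of step functions are thereby again step functions.\<close>

lemma step_fun_map:
  assumes T: "step_partition T m" and "\<phi> 0 = 0"
  shows "\<phi> (step_fun T C m u) = step_fun T (\<lambda>k. \<phi> (C k)) m u"
proof (cases "\<exists>k<m. u \<in> {T k<..T (Suc k)}")
  case True
  then show ?thesis by (auto simp: step_fun_apply[OF T])
next
  case False
  then show ?thesis using assms(2) step_fun_outside[of m u T] by auto
qed

lemma integral_step_fun:
  assumes T: "step_partition T m"
  shows "(LBINT u:{0..1}. step_fun T C m u) = (\<Sum>k<m. C k * (T (Suc k) - T k))"
proof -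
  have sub: "0 \<le> T k" "T k \<le> T (Suc k)" "T (Suc k) \<le> 1" if "k < m" for k
    using step_partition_mono[OF T, of 0 k] step_partition_mono[OF T, of k "Suc k"]
      step_partition_mono[OF T, of "Suc k" m] T that by (auto simp: step_partition_def)
  have "(LBINT u:{0..1}. step_fun T C m u)
    = (LBINT u. (\<Sum>k<m. C k * indicator {T k<..T (Suc k)} u))"
    unfolding set_lebesgue_integral_def step_fun_def
  proof (rule Bochner_Integration.integral_cong)
    fix u
    show "indicator {0..1} u *\<^sub>R (\<Sum>k<m. C k * indicator {T k<..T (Suc k)} u)
      = (\<Sum>k<m. C k * indicator {T k<..T (Suc k)} u)"
      unfolding real_scaleR_def sum_distrib_left
      by (intro sum.cong refl) (use sub in \<open>force simp: indicator_def\<close>)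
  qed simp
  also have "\<dots> = (\<Sum>k<m. LBINT u. C k * indicator {T k<..T (Suc k)} u)"
    by (rule Bochner_Integration.integral_sum) (use sub in auto)
  also have "\<dots> = (\<Sum>k<m. C k * (T (Suc k) - T k))"
    using sub by (intro sum.cong) auto
  finally show ?thesis .
qed

text \<open>An equidistant partition finer than the modulus of uniform continuity, with the values
  of \<open>f\<close> at the right endpoints. The point 0 is left out because the intervals are open
  on the left.\<close>

lemma uniform_step_approximation:
  assumes f: "continuous_on {0..1} (f :: real \<Rightarrow> real)" and e: "0 < e"
  shows "\<exists>T C m. step_partition T m \<and> (\<forall>u\<in>{0<..1}. \<bar>step_fun T C m u - f u\<bar> < e)"
proof -
  have "uniformly_continuous_on {0..1} f" by (rule compact_uniformly_continuous[OF f]) simp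
  then obtain d where d: "0 < d" "\<And>x y. x \<in> {0..1} \<Longrightarrow> y \<in> {0..1} \<Longrightarrow> dist x y < d \<Longrightarrow> dist (f x) (f y) < e"
    using e unfolding uniformly_continuous_on_def by metis
  obtain m0 where m0: "1 / real (Suc m0) < d" using nat_approx_posE[OF d(1)] by blast
  define m where "m = Suc m0"
  have m: "0 < real m" "1 / real m < d" using m0 by (auto simp: m_def)
  define T where "T k = real k / real m" for k
  define C where "C k = f (T (Suc k))" for k
  have T: "step_partition T m" using m by (auto simp: step_partition_def T_def divide_strict_right_mono)
  have "\<bar>step_fun T C m u - f u\<bar> < e" if u: "u \<in> {0<..1}" for u
  proof -
    \<comment> \<open>The interval from \<open>k / m\<close> to \<open>(k + 1) / m\<close> that
      contains u is open at its left end, hence the ceiling minus 1 and not the floor.\<close>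
    define k where "k = nat \<lceil>u * real m\<rceil> - 1"
    have pos: "0 < u * real m" using u m by simp
    then have c: "0 < \<lceil>u * real m\<rceil>" by simp
    have k: "real k = of_int \<lceil>u * real m\<rceil> - 1" 
    proof -
      have "int k = \<lceil>u * real m\<rceil> - 1" using c unfolding k_def by linarith
      then show ?thesis by (metis of_int_1 of_int_diff of_int_of_nat_eq)
    qed
    have k1: "real k < u * real m" "u * real m \<le> real k + 1" unfolding k by linarith+
    have "u * real m \<le> real m" using u m by (simp add: mult_left_le_one_le)
    then have km: "k < m" using k1 by linarith
    have uk: "u \<in> {T k<..T (Suc k)}" using k1 m by (auto simp: T_def field_simps)
    have "T (Suc k) \<in> {0..1}" using km m by (auto simp: T_def)
    moreover have "dist (T (Suc k)) u < d"
    proof -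
      have "T (Suc k) - u \<le> T (Suc k) - T k" using uk by simp
      also have "\<dots> = 1 / real m" by (simp add: T_def add_divide_distrib)
      finally show ?thesis using uk m by (simp add: dist_real_def)
    qed
    ultimately have "dist (f (T (Suc k))) (f u) < e" using u by (intro d(2)) auto
    then show ?thesis using step_fun_apply[OF T km uk, of C] by (simp add: C_def dist_real_def)
  qed
  with T show ?thesis by blast
qed

lemma tendsto_abs_powr:
  fixes f :: "'b \<Rightarrow> real"
  assumes "(f \<longlongrightarrow> l) F" "0 < p"
  shows "((\<lambda>x. \<bar>f x\<bar> powr p) \<longlongrightarrow> \<bar>l\<bar> powr p) F"
  by (rule tendsto_powr'[OF tendsto_rabs[OF assms(1)] tendsto_const]) (use assms(2) in simp)

lemma powr_add_le_two_powr:
  fixes a b p :: real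
  assumes "0 \<le> a" "0 \<le> b" "0 < p"
  shows "(a + b) powr p \<le> 2 powr p * (a powr p + b powr p)"
proof -
  have "(a + b) powr p \<le> (2 * max a b) powr p"
    using assms by (intro powr_mono2) auto
  also have "\<dots> = 2 powr p * max a b powr p"
    using assms by (simp add: powr_mult)
  also have "\<dots> \<le> 2 powr p * (a powr p + b powr p)"
    by (intro mult_left_mono) (auto simp: max_def)
  finally show ?thesis .
qed

text \<open>Truncation to [-K, K]; it supplies majorants for step functions that converge only
  pointwise.\<close>

definition clamp_real :: "real \<Rightarrow> real \<Rightarrow> real" where
  "clamp_real K x = max (- K) (min K x)"

lemma clamp_real_facts:
  assumes "0 \<le> K"
  shows "\<bar>clamp_real K x\<bar> \<le> K" "\<bar>clamp_real K x\<bar> \<le> \<bar>x\<bar>" "clamp_real K 0 = 0"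
    "\<bar>x\<bar> \<le> K \<Longrightarrow> clamp_real K x = x" "\<bar>x - clamp_real K x\<bar> \<le> \<bar>x\<bar>"
  using assms by (auto simp: clamp_real_def max_def min_def)

lemma tendsto_clamp_real:
  "(f \<longlongrightarrow> l) F \<Longrightarrow> ((\<lambda>x. clamp_real K (f x)) \<longlongrightarrow> clamp_real K l) F"
  unfolding clamp_real_def by (intro tendsto_intros)

lemma borel_measurable_clamp_real [measurable]: "clamp_real K \<in> borel_measurable borel"
  unfolding clamp_real_def by measurable

lemma step_fun_measurable [measurable]: "step_fun T C m \<in> borel_measurable borel"
  unfolding step_fun_def by measurable

text \<open>Step functions close to continuous approximations of \<open>g\<close> converge to
  \<open>g\<close> almost everywhere, but without a majorant. Truncation at K supplies one: K is
  fixed first, so that truncating \<open>g\<close> costs little, and n is then taken large. The p-th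
  moments are tracked beside the distances, since only \<open>0 < p\<close> is assumed and no
  triangle inequality for the p-norm is invoked.\<close>

lemma Lp_step_approximation_within:
  assumes g[measurable]: "g \<in> borel_measurable borel" and p: "0 < p"
    and int: "set_integrable lborel {0..1} (\<lambda>u. \<bar>g u\<bar> powr p)" and e: "0 < e"
  shows "\<exists>T C m. step_partition T m \<and>
    \<bar>LBINT u:{0..1}. \<bar>g u - step_fun T C m u\<bar> powr p\<bar> < e \<and>
    \<bar>(LBINT u:{0..1}. \<bar>step_fun T C m u\<bar> powr p) - (LBINT u:{0..1}. \<bar>g u\<bar> powr p)\<bar> < e"
proof -
  \<comment> \<open>\<open>measurable_on\<close> means by definition approximation by continuous
    functions off a negligible set.\<close>
  have "g measurable_on UNIV"
    by (rule lebesgue_measurable_imp_measurable_on_real) (auto intro: measurable_completion)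
  then have "\<exists>Q f. negligible Q \<and> (\<forall>n. continuous_on UNIV (f n)) \<and> (\<forall>x. x \<notin> Q \<longrightarrow> (\<lambda>n. f n x) \<longlonglongrightarrow> g x)"
    by (simp add: measurable_on_def)
  then obtain Q f where Q: "negligible Q" and f: "\<And>n. continuous_on UNIV (f n)"
    "\<And>x. x \<notin> Q \<Longrightarrow> (\<lambda>n. f n x) \<longlonglongrightarrow> g x"
    by blast
  have "\<exists>T C m. step_partition T m \<and> (\<forall>u\<in>{0<..1}. \<bar>step_fun T C m u - f n u\<bar> < 1 / real (Suc n))" for n
    by (rule uniform_step_approximation[OF continuous_on_subset[OF f(1)]]) auto
  then obtain T C m where T: "\<And>n. step_partition (T n) (m n)"
    and s: "\<And>n u. u \<in> {0<..1} \<Longrightarrow> \<bar>step_fun (T n) (C n) (m n) u - f n u\<bar> < 1 / real (Suc n)"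
    by metis
  have s_lim: "(\<lambda>n. step_fun (T n) (C n) (m n) u) \<longlonglongrightarrow> g u" if "u \<in> {0<..1}" "u \<notin> Q" for u
  proof -
    have "(\<lambda>n. step_fun (T n) (C n) (m n) u - f n u) \<longlonglongrightarrow> 0"
      by (rule Lim_null_comparison[OF _ LIMSEQ_inverse_real_of_nat])
         (intro always_eventually allI, unfold real_norm_def inverse_eq_divide, rule less_imp_le[OF s[OF that(1)]])
    from tendsto_add[OF this f(2)[OF that(2)]] show ?thesis by simp
  qed
  have ae: "AE u in lborel. u \<in> {0..1} \<longrightarrow> (\<lambda>n. step_fun (T n) (C n) (m n) u) \<longlonglongrightarrow> g u"
  proof -
    have "AE u in lebesgue. u \<notin> Q"
      by (rule AE_not_in) (use Q in \<open>simp add: negligible_iff_null_sets\<close>)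
    then have "AE u in lborel. u \<notin> Q" by (simp only: AE_completion_iff)
    \<comment> \<open>The point 0 is discarded because the approximation holds only on the left-open
      interval.\<close>
    moreover have "AE u in lborel. u \<noteq> (0::real)" by (rule AE_lborel_singleton)
    ultimately show ?thesis
      
    proof eventually_elim
      case (elim u)
      then show ?case using s_lim[of u] by auto
    qed
  qed
  have int': "integrable lborel (\<lambda>u. indicator {0..1} u * \<bar>g u\<bar> powr p)"
    using int by (simp add: set_integrable_def)
  have int_c: "integrable lborel (\<lambda>u::real. indicator {0..1} u * (c::real))" for c
    by auto
  let ?I = "\<lambda>h. LBINT u:{0..1}. \<bar>h u\<bar> powr p :: real"
  let ?cg = "\<lambda>K::nat. \<lambda>u. clamp_real (real K) (g u)"
  let ?cs = "\<lambda>(K::nat) n u. clamp_real (real K) (step_fun (T n) (C n) (m n) u)"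
  have lim1: "(\<lambda>K. ?I (\<lambda>u. g u - ?cg K u)) \<longlonglongrightarrow> 0"
  proof -
    have "(\<lambda>K. ?I (\<lambda>u. g u - ?cg K u)) \<longlonglongrightarrow> (LBINT u::real. (0::real))"
      unfolding set_lebesgue_integral_def real_scaleR_def
    proof (rule integral_dominated_convergence[OF _ _ int'])
      show "AE u in lborel. (\<lambda>K. indicator {0..1} u * \<bar>g u - ?cg K u\<bar> powr p) \<longlonglongrightarrow> 0"
      proof (intro AE_I2 tendsto_eventually)
        fix u
        obtain K0 where "\<bar>g u\<bar> \<le> real K0" using real_arch_simple by blast
        then show "\<forall>\<^sub>F K in sequentially. indicator {0..1} u * \<bar>g u - ?cg K u\<bar> powr p = 0"
          by (intro eventually_sequentiallyI[of K0]) (simp add: clamp_real_facts(4))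
      qed
      show "AE u in lborel. norm (indicator {0..1} u * \<bar>g u - ?cg K u\<bar> powr p) \<le> indicator {0..1} u * \<bar>g u\<bar> powr p" for K
        using p by (simp add: indicator_def powr_mono2 clamp_real_facts(5))
    qed measurable
    then show ?thesis by simp
  qed
  have lim2: "(\<lambda>K. ?I (?cg K)) \<longlonglongrightarrow> ?I g"
    unfolding set_lebesgue_integral_def real_scaleR_def
  proof (rule integral_dominated_convergence[OF _ _ int'])
    show "AE u in lborel. (\<lambda>K. indicator {0..1} u * \<bar>?cg K u\<bar> powr p) \<longlonglongrightarrow> indicator {0..1} u * \<bar>g u\<bar> powr p"
    proof (intro AE_I2 tendsto_eventually)
      fix u
      obtain K0 where "\<bar>g u\<bar> \<le> real K0" using real_arch_simple by blast
      then show "\<forall>\<^sub>F K in sequentially. indicator {0..1} u * \<bar>?cg K u\<bar> powr p = indicator {0..1} u * \<bar>g u\<bar> powr p"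
        by (intro eventually_sequentiallyI[of K0]) (simp add: clamp_real_facts(4))
    qed
    show "AE u in lborel. norm (indicator {0..1} u * \<bar>?cg K u\<bar> powr p) \<le> indicator {0..1} u * \<bar>g u\<bar> powr p" for K
      using p by (simp add: indicator_def powr_mono2 clamp_real_facts(2))
  qed measurable
  have lim3: "(\<lambda>n. ?I (\<lambda>u. g u - ?cs K n u)) \<longlonglongrightarrow> ?I (\<lambda>u. g u - ?cg K u)" for K
    unfolding set_lebesgue_integral_def real_scaleR_def
  proof (rule integral_dominated_convergence)
    let ?w = "\<lambda>u. 2 powr p * (indicator {0..1} u * \<bar>g u\<bar> powr p + indicator {0..1} u * real K powr p)"
    show "integrable lborel ?w"
      by (intro integrable_mult_right Bochner_Integration.integrable_add int' int_c)
    show "AE u in lborel. (\<lambda>n. indicator {0..1} u * \<bar>g u - ?cs K n u\<bar> powr p)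
      \<longlonglongrightarrow> indicator {0..1} u * \<bar>g u - ?cg K u\<bar> powr p"
      using ae
    proof eventually_elim
      case (elim u)
      then show ?case
        by (cases "u \<in> {0..1}") (auto intro!: tendsto_abs_powr tendsto_diff tendsto_clamp_real p)
    qed
    show "AE u in lborel. norm (indicator {0..1} u * \<bar>g u - ?cs K n u\<bar> powr p) \<le> ?w u" for n
    proof (intro AE_I2)
      fix u
      have "\<bar>g u - ?cs K n u\<bar> powr p \<le> (\<bar>g u\<bar> + real K) powr p"
        using p clamp_real_facts(1)[of "real K" "step_fun (T n) (C n) (m n) u"]
        by (intro powr_mono2) auto
      also have "\<dots> \<le> 2 powr p * (\<bar>g u\<bar> powr p + real K powr p)"
        by (rule powr_add_le_two_powr) (use p in auto)
      finally show "norm (indicator {0..1} u * \<bar>g u - ?cs K n u\<bar> powr p) \<le> ?w u"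
        by (auto simp: indicator_def)
    qed
  qed measurable
  have lim4: "(\<lambda>n. ?I (?cs K n)) \<longlonglongrightarrow> ?I (?cg K)" for K
    unfolding set_lebesgue_integral_def real_scaleR_def
  proof (rule integral_dominated_convergence[OF _ _ int_c])
    show "AE u in lborel. (\<lambda>n. indicator {0..1} u * \<bar>?cs K n u\<bar> powr p)
      \<longlonglongrightarrow> indicator {0..1} u * \<bar>?cg K u\<bar> powr p"
      using ae
    proof eventually_elim
      case (elim u)
      then show ?case
        by (cases "u \<in> {0..1}") (auto intro!: tendsto_abs_powr tendsto_clamp_real p)
    qed
    show "AE u in lborel. norm (indicator {0..1} u * \<bar>?cs K n u\<bar> powr p) \<le> indicator {0..1} u * real K powr p" for n
      using p by (simp add: indicator_def powr_mono2 clamp_real_facts(1))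
  qed measurable
  have "\<forall>\<^sub>F K in sequentially. ?I (\<lambda>u. g u - ?cg K u) < e / 2 \<and> dist (?I (?cg K)) (?I g) < e / 2"
    using order_tendstoD(2)[OF lim1, of "e / 2"] tendstoD[OF lim2, of "e / 2"] e by (auto intro: eventually_conj)
  then obtain K where K: "?I (\<lambda>u. g u - ?cg K u) < e / 2" "dist (?I (?cg K)) (?I g) < e / 2"
    by (auto dest: eventually_happens)
  have "\<forall>\<^sub>F n in sequentially. ?I (\<lambda>u. g u - ?cs K n u) < e / 2 \<and> dist (?I (?cs K n)) (?I (?cg K)) < e / 2"
    using order_tendstoD(2)[OF lim3 K(1)] tendstoD[OF lim4, of "e / 2" K] e by (auto intro: eventually_conj)
  then obtain n where n: "?I (\<lambda>u. g u - ?cs K n u) < e / 2" "dist (?I (?cs K n)) (?I (?cg K)) < e / 2"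
    by (auto dest: eventually_happens)
  \<comment> \<open>Truncating the coefficients truncates the step function, which therefore stays
    within the class.\<close>
  define D where "D k = clamp_real (real K) (C n k)" for k
  have cs: "step_fun (T n) D (m n) u = ?cs K n u" for u
    unfolding D_def by (rule step_fun_map[OF T, symmetric]) (simp add: clamp_real_facts(3))
  have "0 \<le> ?I (\<lambda>u. g u - ?cs K n u)"
    unfolding set_lebesgue_integral_def by (intro integral_nonneg_AE) auto
  moreover have "\<And>x::real. 0 \<le> x \<Longrightarrow> x < e / 2 \<Longrightarrow> \<bar>x\<bar> < e" using e by simp
  ultimately have 1: "\<bar>?I (\<lambda>u. g u - ?cs K n u)\<bar> < e" using n(1) by blast
  have "\<bar>x - z\<bar> < e" if "dist x y < e / 2" "dist y z < e / 2" for x y z :: real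
    using that unfolding dist_real_def by linarith
  from this[OF n(2) K(2)] have 2: "\<bar>?I (?cs K n) - ?I g\<bar> < e" .
  show ?thesis
    by (rule exI[of _ "T n"], rule exI[of _ D], rule exI[of _ "m n"], unfold cs) (intro conjI T 1 2)
qed

lemma Lp_step_approximation:
  assumes g: "g \<in> borel_measurable borel" and p: "0 < p"
    and int: "set_integrable lborel {0..1} (\<lambda>u. \<bar>g u\<bar> powr p)"
  obtains T C m where "\<And>j. step_partition (T j) (m j)"
    "(\<lambda>j. LBINT u:{0..1}. \<bar>g u - step_fun (T j) (C j) (m j) u\<bar> powr p) \<longlonglongrightarrow> 0"
    "(\<lambda>j. LBINT u:{0..1}. \<bar>step_fun (T j) (C j) (m j) u\<bar> powr p) \<longlonglongrightarrow> (LBINT u:{0..1}. \<bar>g u\<bar> powr p)"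
proof -
  define P where "P j T C m \<longleftrightarrow> step_partition T m \<and>
    \<bar>LBINT u:{0..1}. \<bar>g u - step_fun T C m u\<bar> powr p\<bar> < 1 / real (Suc j) \<and>
    \<bar>(LBINT u:{0..1}. \<bar>step_fun T C m u\<bar> powr p) - (LBINT u:{0..1}. \<bar>g u\<bar> powr p)\<bar> < 1 / real (Suc j)"
    for j :: nat and T C m
  have "\<forall>j. \<exists>T C m. P j T C m"
    unfolding P_def by (intro allI Lp_step_approximation_within[OF g p int]) simp
  from choice[OF this] obtain T where "\<forall>j. \<exists>C m. P j (T j) C m" ..
  from choice[OF this] obtain C where "\<forall>j. \<exists>m. P j (T j) (C j) m" ..
  from choice[OF this] obtain m where "\<forall>j. P j (T j) (C j) (m j)" ..
  then have Pj: "P j (T j) (C j) (m j)" for j ..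
  have *: "\<And>j. step_partition (T j) (m j)"
    "\<And>j. \<bar>LBINT u:{0..1}. \<bar>g u - step_fun (T j) (C j) (m j) u\<bar> powr p\<bar> < 1 / real (Suc j)"
    "\<And>j. \<bar>(LBINT u:{0..1}. \<bar>step_fun (T j) (C j) (m j) u\<bar> powr p) - (LBINT u:{0..1}. \<bar>g u\<bar> powr p)\<bar> < 1 / real (Suc j)"
    using Pj[unfolded P_def] by (rule conjunct1, rule conjunct1[OF conjunct2], rule conjunct2[OF conjunct2])
  show thesis
  proof (rule that[OF *(1)])
    show "(\<lambda>j. LBINT u:{0..1}. \<bar>g u - step_fun (T j) (C j) (m j) u\<bar> powr p) \<longlonglongrightarrow> 0"
      by (rule Lim_null_comparison[OF _ LIMSEQ_inverse_real_of_nat],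
          intro always_eventually allI, unfold real_norm_def inverse_eq_divide, rule less_imp_le[OF *(2)])
    show "(\<lambda>j. LBINT u:{0..1}. \<bar>step_fun (T j) (C j) (m j) u\<bar> powr p) \<longlonglongrightarrow> (LBINT u:{0..1}. \<bar>g u\<bar> powr p)"
      by (rule LIM_zero_cancel, rule Lim_null_comparison[OF _ LIMSEQ_inverse_real_of_nat],
          intro always_eventually allI, unfold real_norm_def inverse_eq_divide, rule less_imp_le[OF *(3)])
  qed
qed

text \<open>\<open>stable_integral\<close> constrains \<open>Z\<close> only along approximating step
  functions, so one such sequence has to be exhibited. Convergence in probability then carries the
  explicit characteristic functions of the step integrals to the limit.\<close>

lemma char_stable_integral:
  assumes Mo: "stable_motion p N F Mo" and Z: "stable_integral p N Mo g Z"
    and g: "g \<in> borel_measurable borel" and p: "0 < p"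
    and int: "set_integrable lborel {0..1} (\<lambda>u. \<bar>g u\<bar> powr p)"
  shows "char (distr N borel Z) y = complex_of_real (exp (- (\<bar>y\<bar> powr p * (LBINT u:{0..1}. \<bar>g u\<bar> powr p))))"
proof -
  interpret N: prob_space N using Mo by (simp add: stable_motion_def)
  obtain T C m where T: "\<And>j. step_partition (T j) (m j)"
    and lim: "(\<lambda>j. LBINT u:{0..1}. \<bar>g u - step_fun (T j) (C j) (m j) u\<bar> powr p) \<longlonglongrightarrow> 0"
      "(\<lambda>j. LBINT u:{0..1}. \<bar>step_fun (T j) (C j) (m j) u\<bar> powr p) \<longlonglongrightarrow> (LBINT u:{0..1}. \<bar>g u\<bar> powr p)"
    by (rule Lp_step_approximation[OF g p int]) (rule that)
  have Mo_meas: "Mo t \<in> borel_measurable N" if "0 \<le> t" for t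
  proof -
    have "subalgebra N (F t)" "Mo t \<in> borel_measurable (F t)"
      using Mo that by (auto simp: stable_motion_def)
    then show ?thesis by (rule measurable_from_subalg)
  qed
  have [measurable]: "Z \<in> borel_measurable N" using Z by (simp add: stable_integral_def)
  have meas: "step_integral Mo (T j) (C j) (m j) \<in> borel_measurable N" for j
  proof -
    have "0 \<le> T j k" if "k \<le> m j" for k
      using step_partition_mono[OF T, of 0 k j] that T[of j] by (auto simp: step_partition_def)
    then show ?thesis unfolding step_integral_def
      by (intro borel_measurable_sum borel_measurable_times borel_measurable_const borel_measurable_diff Mo_meas) auto
  qed
  have "(\<lambda>j. CLINT \<omega>|N. iexp (y * step_integral Mo (T j) (C j) (m j) \<omega>)) \<longlonglongrightarrow> (CLINT \<omega>|N. iexp (y * Z \<omega>))"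
  proof (rule N.integral_iexp_in_probability[OF meas])
    from Z have "(\<forall>j. step_partition (T j) (m j)) \<longrightarrow>
      (\<lambda>j. LBINT u:{0..1}. \<bar>g u - step_fun (T j) (C j) (m j) u\<bar> powr p) \<longlonglongrightarrow> 0 \<longrightarrow>
      (\<forall>\<epsilon>>0. (\<lambda>j. measure N {\<omega>\<in>space N.
              \<bar>step_integral Mo (T j) (C j) (m j) \<omega> - Z \<omega>\<bar> > \<epsilon>}) \<longlonglongrightarrow> 0)"
      unfolding stable_integral_def by (elim conjE allE)
    then show "(\<lambda>j. measure N {\<omega>\<in>space N. \<bar>step_integral Mo (T j) (C j) (m j) \<omega> - Z \<omega>\<bar> > e}) \<longlonglongrightarrow> 0"
      if "e > 0" for e using T lim(1) that by simp
  qed measurable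
  moreover have "(CLINT \<omega>|N. iexp (y * step_integral Mo (T j) (C j) (m j) \<omega>))
    = complex_of_real (exp (- (\<bar>y\<bar> powr p * (LBINT u:{0..1}. \<bar>step_fun (T j) (C j) (m j) u\<bar> powr p))))" for j
  proof -
    have "(\<lambda>u. \<bar>step_fun (T j) (C j) (m j) u\<bar> powr p) = step_fun (T j) (\<lambda>k. \<bar>C j k\<bar> powr p) (m j)"
      by (rule ext, rule step_fun_map[OF T, of "\<lambda>x. \<bar>x\<bar> powr p"]) simp
    then show ?thesis
      using integral_step_fun[OF T[of j], where C = "\<lambda>k. \<bar>C j k\<bar> powr p"]
        char_step_integral[OF Mo T[of j], where y = y and C = "C j"]
      by simp
  qed
  moreover have "(\<lambda>j. complex_of_real (exp (- (\<bar>y\<bar> powr p * (LBINT u:{0..1}. \<bar>step_fun (T j) (C j) (m j) u\<bar> powr p)))))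
     \<longlonglongrightarrow> complex_of_real (exp (- (\<bar>y\<bar> powr p * (LBINT u:{0..1}. \<bar>g u\<bar> powr p))))"
    by (intro tendsto_of_real tendsto_exp tendsto_minus tendsto_mult tendsto_const lim(2))
  ultimately have "(CLINT \<omega>|N. iexp (y * Z \<omega>)) = complex_of_real (exp (- (\<bar>y\<bar> powr p * (LBINT u:{0..1}. \<bar>g u\<bar> powr p))))"
    using LIMSEQ_unique by auto
  then show ?thesis by (simp add: char_def integral_distr)
qed

subsection \<open>Characteristic functions\<close>

lemma (in prob_space) expectation_power2_le:
  fixes f :: "'a \<Rightarrow> real"
  assumes "integrable M f" "integrable M (\<lambda>x. (f x)\<^sup>2)"
  shows "(expectation f)\<^sup>2 \<le> expectation (\<lambda>x. (f x)\<^sup>2)"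
proof -
  have "0 \<le> expectation (\<lambda>x. (f x - expectation f)\<^sup>2)" by (intro integral_nonneg_AE) auto
  then show ?thesis using variance_eq[OF assms] by simp
qed

text \<open>The increments of a characteristic function are controlled by its values near the origin.\<close>

lemma (in real_distribution) char_increment_bound:
  "(cmod (char M t - char M s))\<^sup>2 \<le> 2 * (1 - Re (char M (t - s)))"
proof -
  let ?d = "\<lambda>x. iexp (t * x) - iexp (s * x)"
  have int: "integrable M (\<lambda>x. iexp (u * x))" for u by (intro integrable_iexp) auto
  have sq: "(cmod (?d x))\<^sup>2 = 2 - 2 * cos ((t - s) * x)" for x
  proof -
    have "(cmod (?d x))\<^sup>2 = (cos (t * x) - cos (s * x))\<^sup>2 + (sin (t * x) - sin (s * x))\<^sup>2"
      by (simp add: cmod_power2 Re_exp Im_exp)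
    also have "\<dots> = 2 - 2 * (cos (t * x) * cos (s * x) + sin (t * x) * sin (s * x))"
      using sin_cos_squared_add[of "t * x"] sin_cos_squared_add[of "s * x"]
      by (simp add: power2_diff algebra_simps)
    finally show ?thesis by (simp add: cos_diff left_diff_distrib)
  qed
  have bd: "integrable M (\<lambda>x. 2 - 2 * cos ((t - s) * x))"
    by (intro Bochner_Integration.integrable_diff integrable_mult_right integrable_const
        integrable_const_bound[where B = 1]) auto
  have "(cmod (char M t - char M s))\<^sup>2 = (cmod (CLINT x|M. ?d x))\<^sup>2"
    unfolding char_def using int by (subst Bochner_Integration.integral_diff) auto
  also have "\<dots> \<le> (\<integral>x. cmod (?d x) \<partial>M)\<^sup>2"
    by (intro power_mono integral_norm_bound) auto
  also have "\<dots> \<le> (\<integral>x. (cmod (?d x))\<^sup>2 \<partial>M)"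
    by (rule expectation_power2_le) (use int bd in \<open>auto simp: sq simp del: of_real_mult\<close>)
  also have "\<dots> = (\<integral>x. 2 - 2 * cos ((t - s) * x) \<partial>M)" by (simp only: sq)
  also have "\<dots> = 2 - 2 * (\<integral>x. cos ((t - s) * x) \<partial>M)"
  proof -
    have "integrable M (\<lambda>x. cos ((t - s) * x))"
      by (intro integrable_const_bound[where B = 1]) auto
    then show ?thesis by (simp add: prob_space del: space_eq_univ)
  qed
  also have "(\<integral>x. cos ((t - s) * x) \<partial>M) = Re (char M (t - s))"
  proof -
    have "Re (CLINT x|M. iexp ((t - s) * x)) = (\<integral>x. Re (iexp ((t - s) * x)) \<partial>M)"
      by (rule integral_Re[symmetric, OF int])
    then show ?thesis by (simp add: char_def Re_exp)
  qed
  finally show ?thesis by simp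
qed

lemma AE_lborel_obtain_near_zero:
  assumes "AE u in lborel. P (u :: real)" "0 < d"
  obtains u where "\<bar>u\<bar> < d" "P u"
proof -
  have "\<exists>u. \<bar>u\<bar> < d \<and> P u"
  proof (rule ccontr)
    assume "\<not> ?thesis"
    then have "\<forall>u. P u \<longrightarrow> u \<notin> {-d<..<d}" by auto
    then have "AE u in lborel. u \<notin> {-d<..<d}" using assms(1) by (auto elim: eventually_mono)
    then have "{-d<..<d} \<in> null_sets lborel" by (subst AE_iff_null_sets) auto
    then have "emeasure lborel {-d<..<d} = 0" by auto
    then show False using assms(2) by simp
  qed
  then show ?thesis using that by blast
qed

text \<open>Every \<open>t\<close> has points \<open>t - u\<close> of the set of convergence arbitrarily near with \<open>u\<close> in that set too,
  so the increment bound upgrades convergence almost everywhere to convergence everywhere.\<close>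

lemma char_tendsto_of_AE:
  assumes M: "\<And>n. real_distribution (M n)" and M': "real_distribution M'"
    and conv: "AE t in lborel. (\<lambda>n. char (M n) t) \<longlonglongrightarrow> char M' t"
  shows "(\<lambda>n. char (M n) t) \<longlonglongrightarrow> char M' t"
proof (rule LIMSEQ_I)
  interpret Mn: real_distribution "M n" for n by (rule M)
  interpret M': real_distribution M' by (rule M')
  fix e :: real assume e: "0 < e"
  \<comment> \<open>Any \<open>\<eta>\<close> with \<open>4 * \<eta> \<le> (e / 3)\<^sup>2\<close>
    serves: the squared increment over u is at most twice \<open>1 - Re (char (M n) u)\<close>,
    which will be below \<open>2 * \<eta>\<close>.\<close>
  define \<eta> where "\<eta> = e\<^sup>2 / 72"
  have \<eta>: "0 < \<eta>" using e by (simp add: \<eta>_def)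
  from M'.isCont_char[of 0] obtain d1 where d1: "0 < d1" "\<And>u. \<bar>u\<bar> < d1 \<Longrightarrow> cmod (char M' u - 1) < \<eta>"
    using \<eta> unfolding continuous_at_eps_delta by (auto simp: M'.char_zero dist_norm)
  from M'.isCont_char[of t] obtain d2 where d2: "0 < d2" "\<And>u. \<bar>u - t\<bar> < d2 \<Longrightarrow> cmod (char M' u - char M' t) < e / 3"
    using e unfolding continuous_at_eps_delta
    by (metis dist_norm divide_pos_pos real_norm_def zero_less_numeral)
  obtain Q where Q: "Q \<in> null_sets lborel" "\<And>u. u \<notin> Q \<Longrightarrow> (\<lambda>n. char (M n) u) \<longlonglongrightarrow> char M' u"
    using conv unfolding eventually_ae_filter by (auto simp: subset_eq)
  have [measurable]: "Q \<in> sets borel" using Q(1) by auto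
  have "AE u in lborel. u \<notin> Q" by (rule AE_not_in[OF Q(1)])
  \<comment> \<open>The map from u to t - u preserves null sets, so both u and t - u can be points
    of convergence.\<close>
  moreover from this have "AE u in lborel. t + (-1) * u \<notin> Q"
    by (intro AE_borel_affine[where P = "\<lambda>u. u \<notin> Q"]) auto
  ultimately have "AE u in lborel. u \<notin> Q \<and> t + (-1) * u \<notin> Q" by eventually_elim auto
  then obtain u where u: "\<bar>u\<bar> < min d1 d2" "u \<notin> Q" "t - u \<notin> Q"
    using AE_lborel_obtain_near_zero[of "\<lambda>u. u \<notin> Q \<and> t + (-1) * u \<notin> Q" "min d1 d2"] d1(1) d2(1) by auto
  have "\<forall>\<^sub>F n in sequentially. dist (char (M n) u) (char M' u) < \<eta>"
    by (rule tendstoD[OF Q(2)[OF u(2)] \<eta>])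
  moreover have "\<forall>\<^sub>F n in sequentially. dist (char (M n) (t - u)) (char M' (t - u)) < e / 3"
    by (rule tendstoD[OF Q(2)[OF u(3)]]) (use e in simp)
  ultimately have "\<forall>\<^sub>F n in sequentially. norm (char (M n) t - char M' t) < e"
  proof eventually_elim
    case (elim n)
    have "cmod (char (M n) u - 1) \<le> cmod (char (M n) u - char M' u) + cmod (char M' u - 1)"
      using norm_triangle_ineq[of "char (M n) u - char M' u" "char M' u - 1"] by simp
    also have "\<dots> < 2 * \<eta>" using elim(1) d1(2)[of u] u(1) by (simp add: dist_norm)
    finally have "1 - Re (char (M n) u) < 2 * \<eta>"
      using complex_Re_le_cmod[of "1 - char (M n) u"] by (simp add: norm_minus_commute)
    then have "(cmod (char (M n) t - char (M n) (t - u)))\<^sup>2 < (e / 3)\<^sup>2"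
    proof -
      have "(cmod (char (M n) t - char (M n) (t - u)))\<^sup>2 \<le> 2 * (1 - Re (char (M n) u))"
        using Mn.char_increment_bound[of n t "t - u"] by simp
      also have "\<dots> < 4 * \<eta>" using mult_strict_left_mono[OF \<open>1 - Re (char (M n) u) < 2 * \<eta>\<close>, of 2] by simp
      also have "\<dots> \<le> (e / 3)\<^sup>2" by (simp add: \<eta>_def power2_eq_square)
      finally show ?thesis .
    qed
    then have 1: "cmod (char (M n) t - char (M n) (t - u)) < e / 3"
      by (rule power2_less_imp_less) (use e in simp)
    have 2: "cmod (char M' (t - u) - char M' t) < e / 3" using d2(2)[of "t - u"] u(1) by simp
    have "char (M n) t - char M' t = (char (M n) t - char (M n) (t - u))
      + (char (M n) (t - u) - char M' (t - u)) + (char M' (t - u) - char M' t)" by simp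
    also have "cmod \<dots> \<le> cmod (char (M n) t - char (M n) (t - u))
      + cmod (char (M n) (t - u) - char M' (t - u)) + cmod (char M' (t - u) - char M' t)"
      by (meson add_right_mono norm_triangle_le order_refl order_trans norm_triangle_ineq)
    also have "\<dots> < e" using 1 2 elim(2) unfolding dist_norm by linarith
    finally show ?case .
  qed
  then show "\<exists>no. \<forall>n\<ge>no. norm (char (M n) t - char M' t) < e"
    by (simp add: eventually_sequentially)
qed

text \<open>In Levy's inversion formula the kernel is at most b - a in modulus. An interval with
  massless endpoints therefore has measure at most its length times the integral of the modulus of
  the characteristic function; such intervals shrink to x.\<close>

lemma (in real_distribution) no_atom_of_integrable_char:
  assumes int: "integrable lborel (char M)"
  shows "measure M {x} = 0"
proof -
  define L where "L = (LBINT t. cmod (char M t))"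
  have L: "0 \<le> L" unfolding L_def by (intro integral_nonneg_AE) auto
  have ivl: "measure M {a<..b} \<le> (b - a) * L" if "a \<le> b" "measure M {a} = 0" "measure M {b} = 0" for a b
  proof -
    have lim: "(\<lambda>T. norm (1 / (2 * pi) * (CLBINT t=-T..T. (iexp (-(t * a)) - iexp (-(t * b))) / (\<i> * t) * char M t)))
      \<longlonglongrightarrow> norm (complex_of_real (measure M {a<..b}))"
      by (rule tendsto_norm[OF Levy_Inversion[OF that]])
    have "norm (1 / (2 * pi) * (CLBINT t=-real T..real T. (iexp (-(t * a)) - iexp (-(t * b))) / (\<i> * t) * char M t))
      \<le> (b - a) * L" for T :: nat
    proof -
      let ?h = "\<lambda>t. (iexp (-(t * a)) - iexp (-(t * b))) / (\<i> * t) * char M t"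
      have h: "cmod (?h t) \<le> (b - a) * cmod (char M t)" for t
      proof (cases "t = 0")
        case False
        then have "cmod ((iexp (t * - a) - iexp (t * - b)) / (\<i> * t)) \<le> b - a"
          using Levy_Inversion_aux2[of "-b" "-a" t] that(1) by simp
        then show ?thesis unfolding norm_mult by (intro mult_right_mono) auto
      qed (use that in simp)
      have "(CLBINT t=-real T..real T. ?h t) = (CLBINT t. indicator (einterval (- ereal (real T)) (ereal (real T))) t *\<^sub>R ?h t)"
        by (simp add: interval_lebesgue_integral_def set_lebesgue_integral_def del: of_real_mult)
      also have "norm \<dots> \<le> (LBINT t. (b - a) * cmod (char M t))"
      proof (rule order_trans[OF integral_norm_bound], rule integral_mono')
        show "integrable lborel (\<lambda>t. (b - a) * cmod (char M t))" using int by auto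
        fix t
        show "0 \<le> (b - a) * cmod (char M t)" using that by simp
        show "norm (indicat_real (einterval (- ereal (real T)) (ereal (real T))) t *\<^sub>R ?h t) \<le> (b - a) * cmod (char M t)"
          using h[of t] that(1) by (simp add: indicator_def)
      qed
      also have "\<dots> = (b - a) * L" by (simp add: L_def)
      finally have "norm (CLBINT t=-real T..real T. ?h t) \<le> (b - a) * L" .
      \<comment> \<open>The factor \<open>1 / (2 * pi)\<close> is used only through being at most
        1.\<close>
      moreover have "norm (1 / (2 * pi) * (CLBINT t=-real T..real T. ?h t)) \<le> 1 * norm (CLBINT t=-real T..real T. ?h t)"
        unfolding norm_mult by (intro mult_right_mono) (use pi_gt3 in \<open>auto simp: norm_divide norm_mult\<close>)
      ultimately show ?thesis by simp
    qed
    from LIMSEQ_le_const2[OF lim] this show ?thesis by (simp del: of_real_mult)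
  qed
  \<comment> \<open>The inversion formula needs endpoints that are not atoms; as atoms are
    countable, every interval contains suitable points.\<close>
  have na: "\<exists>z. a < z \<and> z < b \<and> measure M {z} = 0" if "a < b" for a b :: real
  proof -
    have "uncountable ({a<..<b} - {x. measure M {x} > 0})"
      using that countable_atoms by (intro uncountable_minus_countable) (auto simp: uncountable_open_interval)
    then obtain z where "z \<in> {a<..<b} - {x. measure M {x} > 0}"
      by (metis countable_empty ex_in_conv)
    then show ?thesis by (auto simp: zero_less_measure_iff intro!: exI[of _ z])
  qed
  have "measure M {x} \<le> e" if e: "0 < e" for e
  proof -
    define d where "d = e / (2 * (L + 1))"
    have d: "0 < d" "2 * d * L \<le> e" using e L by (auto simp: d_def field_simps)
    obtain a where a: "x - d < a" "a < x" "measure M {a} = 0" using na[of "x - d" x] d by auto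
    obtain b where b: "x < b" "b < x + d" "measure M {b} = 0" using na[of x "x + d"] d by auto
    have "measure M {x} \<le> measure M {a<..b}" by (rule finite_measure_mono) (use a b in auto)
    also have "\<dots> \<le> (b - a) * L" by (rule ivl) (use a b in auto)
    also have "\<dots> \<le> 2 * d * L" by (rule mult_right_mono) (use a b L in auto)
    finally show ?thesis using d by simp
  qed
  then have "measure M {x} \<le> 0" by (rule field_le_epsilon[of _ 0, simplified])
  then show ?thesis by (simp add: measure_le_0_iff)
qed

text \<open>From \<open>\<bar>t\<bar> - 1 \<le> \<bar>t\<bar> powr p\<close> comes the majorant
  \<open>exp c * exp (- (c * \<bar>t\<bar>))\<close>, itself dominated by two rescaled one-sided
  exponentials, one per half-line.\<close>

lemma integrable_exp_abs_powr:
  assumes c: "0 < c" and p: "1 \<le> p"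
  shows "integrable lborel (\<lambda>t::real. exp (- (c * \<bar>t\<bar> powr p)))"
proof -
  let ?f = "\<lambda>x::real. exp (- x) * x ^ 0 * indicator {0..} x"
  have f: "integrable lborel ?f"
    using has_bochner_integral_I0i_power_exp_m'[of 0] by (simp add: has_bochner_integral_iff mult.commute)
  have "integrable lborel (\<lambda>t. exp c * (?f (0 + c * t) + ?f (0 + (- c) * t)))"
    using c by (intro integrable_mult_right Bochner_Integration.integrable_add lborel_integrable_real_affine f) auto
  then show ?thesis
  proof (rule Bochner_Integration.integrable_bound)
    show "AE t in lborel. norm (exp (- (c * \<bar>t\<bar> powr p))) \<le> norm (exp c * (?f (0 + c * t) + ?f (0 + (- c) * t)))"
    proof (intro AE_I2)
      fix t :: real
      have "\<bar>t\<bar> - 1 \<le> \<bar>t\<bar> powr p"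
      proof (cases "\<bar>t\<bar> \<ge> 1")
        case True
        then have "\<bar>t\<bar> powr 1 \<le> \<bar>t\<bar> powr p" using p by (intro powr_mono) auto
        then show ?thesis using True by simp
      next
        case False
        then have "\<bar>t\<bar> - 1 \<le> 0" by simp
        also have "0 \<le> \<bar>t\<bar> powr p" by simp
        finally show ?thesis .
      qed
      then have "c * (\<bar>t\<bar> - 1) \<le> c * \<bar>t\<bar> powr p" using c by (intro mult_left_mono) auto
      then have "exp (- (c * \<bar>t\<bar> powr p)) \<le> exp c * exp (- (c * \<bar>t\<bar>))"
        unfolding exp_add[symmetric] by (simp add: algebra_simps)
      also have "exp (- (c * \<bar>t\<bar>)) \<le> ?f (0 + c * t) + ?f (0 + (- c) * t)"
        using c by (cases "0 \<le> t") (auto simp: indicator_def mult_le_0_iff zero_le_mult_iff)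
      finally show "norm (exp (- (c * \<bar>t\<bar> powr p))) \<le> norm (exp c * (?f (0 + c * t) + ?f (0 + (- c) * t)))"
        by (auto simp: indicator_def)
    qed
  qed measurable
qed

subsection \<open>Logarithmic means\<close>

definition log_sum :: "(nat \<Rightarrow> 'a) \<Rightarrow> nat \<Rightarrow> 'a::real_normed_vector" where
  "log_sum f K = (\<Sum>n=1..K. f n /\<^sub>R real n)"

text \<open>Dividing by \<open>harm K\<close> and not by \<open>ln K\<close> makes the weights sum
  to exactly 1, so that the means are integrals against probability measures. The logarithm returns
  through \<open>harm_div_ln_tendsto\<close>.\<close>

definition log_mean :: "(nat \<Rightarrow> 'a) \<Rightarrow> nat \<Rightarrow> 'a::real_normed_vector" where
  "log_mean f K = log_sum f K /\<^sub>R harm K"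

lemma harm_real: "harm K = (\<Sum>n=1..K. inverse (real n))"
  by (simp add: harm_def)

lemma harm_le_ln: "1 \<le> n \<Longrightarrow> harm n \<le> ln (real n) + 1"
  using euler_mascheroni_sequence_decreasing[of 1 n] by (simp add: harm_expand)

lemma harm_ge_one: "1 \<le> n \<Longrightarrow> (1::real) \<le> harm n"
  using harm_mono[of 1 n, where 'a = real] by (simp add: harm_expand)

lemma log_sum_diff_bound:
  assumes "k \<le> K" and B: "\<And>n. k < n \<Longrightarrow> norm (f n) \<le> B"
  shows "norm (log_sum f K - log_sum f k) \<le> B * (harm K - harm k)"
  using assms(1)
proof (induction rule: dec_induct)
  case (step n)
  have "log_sum f (Suc n) - log_sum f k = (log_sum f n - log_sum f k) + f (Suc n) /\<^sub>R real (Suc n)"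
    by (simp add: log_sum_def)
  also have "norm \<dots> \<le> B * (harm n - harm k) + B / real (Suc n)"
    using step B[of "Suc n"]
    by (intro order_trans[OF norm_triangle_ineq] add_mono) (auto simp: divide_inverse mult_right_mono mult.commute)
  also have "\<dots> = B * (harm (Suc n) - harm k)"
    by (simp add: harm_Suc algebra_simps divide_inverse)
  finally show ?case .
qed simp

text \<open>The analogue of Cesaro's theorem: the weights have divergent sum, so every initial
  segment becomes negligible.\<close>

lemma log_mean_tendsto:
  assumes "f \<longlonglongrightarrow> a"
  shows "log_mean f \<longlonglongrightarrow> (a :: 'a::real_normed_vector)"
proof (rule LIMSEQ_I)
  fix e :: real assume e: "0 < e"
  from LIMSEQ_D[OF assms, of "e / 2"] e obtain N where N: "\<And>n. n \<ge> N \<Longrightarrow> norm (f n - a) < e / 2" by auto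
  define C where "C = norm (log_sum (\<lambda>n. f n - a) N)"
  have "\<forall>\<^sub>F K in sequentially. harm K > 2 * C / e + 1"
    using harm_at_top by (auto simp: filterlim_at_top_dense)
  moreover have "\<forall>\<^sub>F K in sequentially. K \<ge> max 1 N" by (rule eventually_ge_at_top)
  ultimately have "\<forall>\<^sub>F K in sequentially. norm (log_mean f K - a) < e"
  proof eventually_elim
    case (elim K)
    then have h: "1 \<le> (harm K :: real)" by (intro harm_ge_one) simp
    have "norm (log_sum (\<lambda>n. f n - a) K) \<le> norm (log_sum (\<lambda>n. f n - a) K - log_sum (\<lambda>n. f n - a) N) + C"
      unfolding C_def using norm_triangle_sub[of "log_sum (\<lambda>n. f n - a) K" "log_sum (\<lambda>n. f n - a) N"]
      by (simp only: add.commute)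
    also have "norm (log_sum (\<lambda>n. f n - a) K - log_sum (\<lambda>n. f n - a) N) \<le> e / 2 * (harm K - harm N)"
      using elim N by (intro log_sum_diff_bound) (auto intro: less_imp_le)
    also have "\<dots> \<le> e / 2 * harm K" using e harm_nonneg[of N, where 'a = real] by (simp add: right_diff_distrib)
    finally have 1: "norm (log_sum (\<lambda>n. f n - a) K) \<le> e / 2 * harm K + C" by simp
    have "log_sum (\<lambda>n. f n - a) K = log_sum f K - harm K *\<^sub>R a"
      by (simp add: log_sum_def harm_real scaleR_right_diff_distrib sum_subtractf scaleR_sum_left)
    then have "log_mean f K - a = log_sum (\<lambda>n. f n - a) K /\<^sub>R harm K"
      using h by (simp add: log_mean_def scaleR_right_diff_distrib)
    then have "norm (log_mean f K - a) = norm (log_sum (\<lambda>n. f n - a) K) / harm K"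
      using h by (simp add: divide_inverse mult.commute)
    also have "\<dots> \<le> (e / 2 * harm K + C) / harm K" using 1 h by (intro divide_right_mono) auto
    also have "\<dots> < e"
    proof -
      have "2 * C < e * harm K" using elim e by (simp add: field_simps)
      then have "e / 2 * harm K + C < e * harm K" by linarith
      moreover have "0 < (harm K :: real)" using h by linarith
      ultimately show ?thesis by (simp only: pos_divide_less_eq)
    qed
    finally show ?case .
  qed
  then show "\<exists>no. \<forall>n\<ge>no. norm (log_mean f n - a) < e" by (simp add: eventually_sequentially)
qed

text \<open>Each term is at most twice the difference of consecutive square roots, and these
  differences telescope.\<close>

lemma sum_inverse_sqrt_le: "(\<Sum>n=1..m. 1 / sqrt (real n)) \<le> 2 * sqrt (real m)"
proof (induction m)
  case (Suc m)
  have pos: "0 < sqrt (real (Suc m)) + sqrt (real m)" by (simp add: add_pos_nonneg)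
  have "1 = (sqrt (real (Suc m)) - sqrt (real m)) * (sqrt (real (Suc m)) + sqrt (real m))"
    by (simp add: algebra_simps)
  also have "\<dots> \<le> (sqrt (real (Suc m)) - sqrt (real m)) * (2 * sqrt (real (Suc m)))"
    by (intro mult_left_mono) auto
  finally have "1 / sqrt (real (Suc m)) \<le> 2 * (sqrt (real (Suc m)) - sqrt (real m))"
    by (simp add: field_simps)
  with Suc show ?case by simp
qed simp

text \<open>Off-diagonal decay \<open>sqrt (n / m)\<close> makes the logarithmically weighted double sum of the
  covariances of the order of its diagonal.\<close>

lemma log_double_sum_le:
  assumes C: "0 \<le> C"
    and c: "\<And>n m. 1 \<le> n \<Longrightarrow> n \<le> m \<Longrightarrow> c n m \<le> C * sqrt (real n / real m) \<and> c m n \<le> C * sqrt (real n / real m)"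
  shows "(\<Sum>n=1..K. \<Sum>m=1..K. c n m / (real n * real m)) \<le> 4 * C * harm K"
proof -
  \<comment> \<open>On the triangle n \<le> m this is \<open>C * sqrt (n / m) / (n * m)\<close>,
    factored so that the inner sum over n is the one of \<open>sum_inverse_sqrt_le\<close>. The two
    triangles and the 2 of that lemma make up the 4.\<close>
  define g where "g n m = (if n \<le> m then C / real m * (1 / sqrt (real m) * (1 / sqrt (real n))) else 0)" for n m :: nat
  have gval: "C * sqrt (real n / real m) / (real n * real m) = g n m" if "1 \<le> n" "n \<le> m" for n m
  proof -
    have "sqrt (real n) / real n = 1 / sqrt (real n)"
      using that by (simp add: real_div_sqrt field_simps)
    then show ?thesis using that by (simp add: g_def real_sqrt_divide field_simps)
  qed
  have g0: "0 \<le> g n m" for n m using C by (simp add: g_def)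
  have le: "c n m / (real n * real m) \<le> g n m + g m n" if "1 \<le> n" "1 \<le> m" for n m
  proof (cases "n \<le> m")
    case True
    then have "c n m / (real n * real m) \<le> C * sqrt (real n / real m) / (real n * real m)"
      using c[OF that(1) True] by (intro divide_right_mono) auto
    then show ?thesis using gval[OF that(1) True] g0[of m n] by simp
  next
    case False
    then have "m \<le> n" by simp
    then have "c n m / (real n * real m) \<le> C * sqrt (real m / real n) / (real m * real n)"
      using c[OF that(2) \<open>m \<le> n\<close>] by (subst mult.commute[of "real n"], intro divide_right_mono) auto
    then show ?thesis using gval[OF that(2) \<open>m \<le> n\<close>] g0[of n m] by simp
  qed
  have inner: "(\<Sum>n=1..K. g n m) \<le> 2 * C * inverse (real m)" if "m \<in> {1..K}" for m
  proof -
    have "(\<Sum>n=1..K. g n m) = (\<Sum>n=1..m. C / real m * (1 / sqrt (real m) * (1 / sqrt (real n))))"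
      using that by (intro sum.mono_neutral_cong_right) (auto simp: g_def)
    also have "\<dots> = C / real m * (1 / sqrt (real m) * (\<Sum>n=1..m. 1 / sqrt (real n)))"
      by (simp add: sum_distrib_left)
    also have "\<dots> \<le> C / real m * (1 / sqrt (real m) * (2 * sqrt (real m)))"
      using C sum_inverse_sqrt_le[of m] by (intro mult_left_mono) auto
    also have "\<dots> = 2 * C * inverse (real m)" using that by (simp add: divide_inverse)
    finally show ?thesis .
  qed
  have "(\<Sum>n=1..K. \<Sum>m=1..K. c n m / (real n * real m)) \<le> (\<Sum>n=1..K. \<Sum>m=1..K. g n m + g m n)"
    by (intro sum_mono le) auto
  also have "\<dots> = (\<Sum>n=1..K. \<Sum>m=1..K. g n m) + (\<Sum>n=1..K. \<Sum>m=1..K. g m n)"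
    by (simp add: sum.distrib)
  also have "(\<Sum>n=1..K. \<Sum>m=1..K. g n m) = (\<Sum>n=1..K. \<Sum>m=1..K. g m n)" by (rule sum.swap)
  also have "\<dots> + \<dots> = 2 * (\<Sum>m=1..K. \<Sum>n=1..K. g n m)" by simp
  also have "\<dots> \<le> 2 * (\<Sum>m=1..K. 2 * C * inverse (real m))"
    by (intro mult_left_mono sum_mono inner) auto
  also have "\<dots> = 4 * C * harm K" by (simp add: harm_real sum_distrib_left mult.assoc)
  finally show ?thesis .
qed

text \<open>Borel-Cantelli in integral form: the series of the functions has finite integral, hence
  converges almost everywhere, and its terms vanish.\<close>

lemma AE_tendsto_zero_of_summable_integral:
  fixes f :: "nat \<Rightarrow> 'a \<Rightarrow> real"
  assumes int: "\<And>j. integrable M (f j)" and nn: "\<And>j x. 0 \<le> f j x"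
    and sm: "summable (\<lambda>j. integral\<^sup>L M (f j))"
  shows "AE x in M. (\<lambda>j. f j x) \<longlonglongrightarrow> 0"
proof -
  have [measurable]: "f j \<in> borel_measurable M" for j using int by auto
  have "(\<integral>\<^sup>+x. (\<Sum>j. ennreal (f j x)) \<partial>M) = (\<Sum>j. \<integral>\<^sup>+x. ennreal (f j x) \<partial>M)"
    by (rule nn_integral_suminf) measurable
  also have "\<dots> = (\<Sum>j. ennreal (integral\<^sup>L M (f j)))"
    by (simp add: nn_integral_eq_integral[OF int] nn)
  also have "\<dots> = ennreal (\<Sum>j. integral\<^sup>L M (f j))"
    by (rule suminf_ennreal2[OF _ sm]) (simp add: nn)
  also have "\<dots> \<noteq> \<infinity>" by simp
  finally have "AE x in M. (\<Sum>j. ennreal (f j x)) \<noteq> \<infinity>"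
    by (intro nn_integral_PInf_AE) auto
  then show ?thesis
  proof eventually_elim
    case (elim x)
    then have "summable (\<lambda>j. f j x)"
      by (intro summable_suminf_not_top) (auto simp: nn)
    then show ?case by (rule summable_LIMSEQ_zero)
  qed
qed

lemma harm_two_power_square:
  shows "real j ^ 2 * ln 2 \<le> harm (2 ^ j\<^sup>2)" "harm (2 ^ j\<^sup>2) \<le> real j ^ 2 * ln 2 + 1"
proof -
  have ln: "ln (real (2 ^ j\<^sup>2)) = real j ^ 2 * ln 2" by (simp add: ln_realpow)
  have "ln (real (2 ^ j\<^sup>2)) \<le> ln (real (2 ^ j\<^sup>2) + 1)" by (subst ln_le_cancel_iff) (auto simp: add_pos_pos)
  then show "real j ^ 2 * ln 2 \<le> harm (2 ^ j\<^sup>2)" using ln_le_harm[of "2 ^ j\<^sup>2"] ln by linarith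
  show "harm (2 ^ j\<^sup>2) \<le> real j ^ 2 * ln 2 + 1" using harm_le_ln[of "2 ^ j\<^sup>2"] ln by simp
qed

text \<open>Along \<open>2 ^ j\<^sup>2\<close> the harmonic numbers grow like \<open>j\<^sup>2\<close>: fast enough for Borel-Cantelli,
  slowly enough that consecutive ones are asymptotically equal.\<close>

lemma log_mean_interpolation:
  assumes B: "\<And>n. norm (d n) \<le> B"
    and sub: "(\<lambda>j. log_mean d (2 ^ j\<^sup>2)) \<longlonglongrightarrow> 0"
  shows "log_mean d \<longlonglongrightarrow> 0"
proof (rule LIMSEQ_I)
  fix e :: real assume e: "0 < e"
  have B0: "0 \<le> B" using B[of 0] norm_ge_zero[of "d 0"] by linarith
  define h where "h j = (harm (2 ^ j\<^sup>2) :: real)" for j :: nat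
  have h1: "1 \<le> h j" for j unfolding h_def by (rule harm_ge_one) simp
  have gap: "(\<lambda>j. B * ((h (Suc j) - h j) / h j)) \<longlonglongrightarrow> 0"
  proof -
    \<comment> \<open>For j \<ge> 1 the increment of \<open>h\<close> is at most
      \<open>1 + (2 * j + 1) * ln 2\<close>, hence at most j times \<open>1 + 3 * ln 2\<close>,
      while \<open>h j\<close> is at least \<open>j\<^sup>2 * ln 2\<close>.\<close>
    define c where "c = (1 + 3 * ln 2) / (ln 2 :: real)"
    have "(\<lambda>j. c / real j) \<longlonglongrightarrow> 0" by (rule lim_const_over_n)
    moreover have "\<forall>\<^sub>F j in sequentially. norm ((h (Suc j) - h j) / h j) \<le> c / real j"
    proof (rule eventually_sequentiallyI[of 1])
      fix j :: nat assume j: "1 \<le> j"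
      have mono: "h j \<le> h (Suc j)" unfolding h_def by (intro harm_mono power_increasing power_mono) auto
      have "h (Suc j) - h j \<le> real (Suc j) ^ 2 * ln 2 + 1 - real j ^ 2 * ln 2"
        using harm_two_power_square(2)[of "Suc j"] harm_two_power_square(1)[of j] by (simp add: h_def)
      also have "\<dots> = 1 + (2 * real j + 1) * ln 2" by (simp add: power2_eq_square algebra_simps)
      also have "\<dots> \<le> real j + (2 * real j + real j) * ln 2"
        using j by (intro add_mono mult_right_mono) auto
      also have "\<dots> = real j * (1 + 3 * ln 2)" by (simp add: algebra_simps)
      finally have "(h (Suc j) - h j) / h j \<le> real j * (1 + 3 * ln 2) / (real j ^ 2 * ln 2)"
        using harm_two_power_square(1)[of j] j by (intro frac_le) (auto simp: h_def)
      also have "\<dots> = c / real j" using j by (simp add: c_def power2_eq_square)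
      finally show "norm ((h (Suc j) - h j) / h j) \<le> c / real j" using mono h1[of j] by simp
    qed
    ultimately have "(\<lambda>j. (h (Suc j) - h j) / h j) \<longlonglongrightarrow> 0" by (rule Lim_null_comparison[rotated])
    from tendsto_mult[OF tendsto_const this] show ?thesis by simp
  qed
  have "\<forall>\<^sub>F j in sequentially. norm (log_mean d (2 ^ j\<^sup>2)) < e / 2 \<and> B * ((h (Suc j) - h j) / h j) < e / 2"
    using tendstoD[OF sub, of "e / 2"] order_tendstoD(2)[OF gap, of "e / 2"] e
    by (intro eventually_conj) auto
  then obtain j0 where j0: "\<And>j. j \<ge> j0 \<Longrightarrow> norm (log_mean d (2 ^ j\<^sup>2)) < e / 2"
    "\<And>j. j \<ge> j0 \<Longrightarrow> B * ((h (Suc j) - h j) / h j) < e / 2"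
    unfolding eventually_sequentially by blast
  show "\<exists>no. \<forall>K\<ge>no. norm (log_mean d K - 0) < e"
  proof (intro exI allI impI)
    fix K :: nat assume K: "2 ^ j0\<^sup>2 \<le> K"
    have bound: "j \<le> K" if "2 ^ j\<^sup>2 \<le> K" for j :: nat
    proof -
      have "j \<le> j\<^sup>2" by (simp add: power2_nat_le_imp_le power2_eq_square)
      also have "\<dots> < 2 ^ j\<^sup>2" by (rule less_exp)
      finally show ?thesis using that by linarith
    qed
    \<comment> \<open>The block that contains K: \<open>bound\<close> makes the greatest index
      exist, and its maximality keeps K below the next block.\<close>
    define j where "j = (GREATEST j. 2 ^ j\<^sup>2 \<le> K)"
    have jK: "2 ^ j\<^sup>2 \<le> K" unfolding j_def by (rule GreatestI_nat[of _ j0 K]) (use K bound in auto)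
    have jge: "j0 \<le> j" unfolding j_def by (rule Greatest_le_nat[of _ _ K]) (use K bound in auto)
    have Kj: "K \<le> 2 ^ (Suc j)\<^sup>2"
    proof (rule ccontr)
      assume "\<not> ?thesis"
      then have "Suc j \<le> j" unfolding j_def by (intro Greatest_le_nat[of _ _ K]) (use bound in auto)
      then show False by simp
    qed
    have hK: "h j \<le> harm K" "harm K \<le> h (Suc j)" unfolding h_def using jK Kj by (auto intro: harm_mono)
    have "norm (log_sum d K) \<le> norm (log_sum d (2 ^ j\<^sup>2)) + norm (log_sum d K - log_sum d (2 ^ j\<^sup>2))"
      by (rule norm_triangle_sub)
    also have "norm (log_sum d K - log_sum d (2 ^ j\<^sup>2)) \<le> B * (harm K - h j)"
      unfolding h_def by (rule log_sum_diff_bound[OF jK B])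
    also have "\<dots> \<le> B * (h (Suc j) - h j)" using hK B0 by (intro mult_left_mono) auto
    finally have 1: "norm (log_sum d K) \<le> norm (log_sum d (2 ^ j\<^sup>2)) + B * (h (Suc j) - h j)" by simp
    have "norm (log_mean d K) = norm (log_sum d K) / harm K"
      using hK h1[of j] by (simp add: log_mean_def divide_inverse mult.commute)
    also have "\<dots> \<le> (norm (log_sum d (2 ^ j\<^sup>2)) + B * (h (Suc j) - h j)) / h j"
      using 1 hK h1[of j] by (intro frac_le) (auto intro: order_trans[OF norm_ge_zero])
    also have "\<dots> = norm (log_mean d (2 ^ j\<^sup>2)) + B * ((h (Suc j) - h j) / h j)"
      using h1[of j] by (simp add: log_mean_def h_def divide_inverse algebra_simps)
    also have "\<dots> < e" using j0[OF jge] by linarith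
    finally show "norm (log_mean d K - 0) < e" by simp
  qed
qed

text \<open>The covariance bound gives the logarithmic sum a second moment of order
  \<open>harm K\<close>, hence the mean one of order \<open>1 / harm K\<close>, which is of order
  \<open>1 / j\<^sup>2\<close> at \<open>2 ^ j\<^sup>2\<close>. The case n = m of \<open>cov\<close>
  bounds the diagonal.\<close>

lemma (in prob_space) log_mean_tendsto_zero_AE:
  fixes f :: "nat \<Rightarrow> 'a \<Rightarrow> complex"
  assumes meas[measurable]: "\<And>n. f n \<in> borel_measurable M"
    and B: "\<And>n \<omega>. cmod (f n \<omega>) \<le> B"
    and C: "0 \<le> C"
    and cov: "\<And>n m. 1 \<le> n \<Longrightarrow> n \<le> m \<Longrightarrow>
      cmod (CLINT \<omega>|M. f n \<omega> * cnj (f m \<omega>)) \<le> C * sqrt (real n / real m)"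
  shows "AE \<omega> in M. log_mean (\<lambda>n. f n \<omega>) \<longlonglongrightarrow> 0"
proof -
  have B0: "0 \<le> B" using B[of 0] norm_ge_zero order_trans by blast
  have [measurable]: "(\<lambda>\<omega>. log_sum (\<lambda>n. f n \<omega>) K) \<in> borel_measurable M" for K
    unfolding log_sum_def by measurable
  have [measurable]: "cnj \<in> borel_measurable borel"
    by (intro borel_measurable_continuous_onI continuous_intros)
  have int_fm: "integrable M (\<lambda>\<omega>. f n \<omega> * cnj (f m \<omega>))" for n m
    by (rule integrable_const_bound[where B = "B * B"])
       (auto simp: norm_mult intro!: mult_mono B B0)
  have cov': "cmod (CLINT \<omega>|M. f m \<omega> * cnj (f n \<omega>)) = cmod (CLINT \<omega>|M. f n \<omega> * cnj (f m \<omega>))" for n m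
  proof -
    have "(CLINT \<omega>|M. f m \<omega> * cnj (f n \<omega>)) = cnj (CLINT \<omega>|M. f n \<omega> * cnj (f m \<omega>))"
      using Bochner_Integration.integral_cnj[of M "\<lambda>\<omega>. f n \<omega> * cnj (f m \<omega>)"] by (simp del: Bochner_Integration.integral_cnj add: mult.commute)
    then show ?thesis by simp
  qed
  have expand: "complex_of_real ((cmod (log_sum (\<lambda>n. f n \<omega>) K))\<^sup>2)
    = (\<Sum>n=1..K. \<Sum>m=1..K. (f n \<omega> * cnj (f m \<omega>)) / complex_of_real (real n * real m))" for K \<omega>
    unfolding complex_norm_square log_sum_def
    by (simp add: sum_product scaleR_conv_of_real divide_inverse mult_ac)
  have sq_int: "integrable M (\<lambda>\<omega>. (cmod (log_sum (\<lambda>n. f n \<omega>) K))\<^sup>2)" for K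
  proof -
    have "integrable M (\<lambda>\<omega>. complex_of_real ((cmod (log_sum (\<lambda>n. f n \<omega>) K))\<^sup>2))"
      unfolding expand by (intro Bochner_Integration.integrable_sum integrable_divide int_fm)
    then show ?thesis by (simp only: complex_of_real_integrable_eq)
  qed
  have second: "(\<integral>\<omega>. (cmod (log_sum (\<lambda>n. f n \<omega>) K))\<^sup>2 \<partial>M) \<le> 4 * C * harm K" for K
  proof -
    have eq: "complex_of_real (\<integral>\<omega>. (cmod (log_sum (\<lambda>n. f n \<omega>) K))\<^sup>2 \<partial>M)
      = (\<Sum>n=1..K. \<Sum>m=1..K. (CLINT \<omega>|M. f n \<omega> * cnj (f m \<omega>)) / complex_of_real (real n * real m))"
      unfolding integral_complex_of_real[symmetric] expand
      by (simp add: Bochner_Integration.integral_sum int_fm del: of_real_mult)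
    have "(\<integral>\<omega>. (cmod (log_sum (\<lambda>n. f n \<omega>) K))\<^sup>2 \<partial>M)
      \<le> cmod (complex_of_real (\<integral>\<omega>. (cmod (log_sum (\<lambda>n. f n \<omega>) K))\<^sup>2 \<partial>M))"
      unfolding norm_of_real by (rule abs_ge_self)
    also have "\<dots> = cmod (\<Sum>n=1..K. \<Sum>m=1..K. (CLINT \<omega>|M. f n \<omega> * cnj (f m \<omega>)) / complex_of_real (real n * real m))"
      by (simp only: eq)
    also have "\<dots> \<le> (\<Sum>n=1..K. \<Sum>m=1..K. cmod (CLINT \<omega>|M. f n \<omega> * cnj (f m \<omega>)) / (real n * real m))"
      by (intro sum_norm_le) (simp add: norm_divide norm_mult)
    also have "\<dots> \<le> 4 * C * harm K"
      by (rule log_double_sum_le[OF C]) (use cov cov' in auto)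
    finally show ?thesis .
  qed
  have "AE \<omega> in M. (\<lambda>j. (cmod (log_mean (\<lambda>n. f n \<omega>) (2 ^ j\<^sup>2)))\<^sup>2) \<longlonglongrightarrow> 0"
  proof (rule AE_tendsto_zero_of_summable_integral)
    have eq: "(cmod (log_mean (\<lambda>n. f n \<omega>) K))\<^sup>2 = (cmod (log_sum (\<lambda>n. f n \<omega>) K))\<^sup>2 / (harm K)\<^sup>2" for \<omega> K
      using harm_nonneg[of K, where 'a = real] by (simp add: log_mean_def divide_inverse power_mult_distrib mult.commute power_inverse)
    show "integrable M (\<lambda>\<omega>. (cmod (log_mean (\<lambda>n. f n \<omega>) (2 ^ j\<^sup>2)))\<^sup>2)" for j
      unfolding eq by (intro integrable_divide sq_int)
    have le: "norm (\<integral>\<omega>. (cmod (log_mean (\<lambda>n. f n \<omega>) (2 ^ j\<^sup>2)))\<^sup>2 \<partial>M) \<le> 4 * C / ln 2 * inverse (real j ^ 2)" if "1 \<le> j" for j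
    proof -
      have h: "real j ^ 2 * ln 2 \<le> harm (2 ^ j\<^sup>2)" by (rule harm_two_power_square)
      have pos: "0 < real j ^ 2 * ln 2" using that by simp
      have "norm (\<integral>\<omega>. (cmod (log_mean (\<lambda>n. f n \<omega>) (2 ^ j\<^sup>2)))\<^sup>2 \<partial>M)
        = (\<integral>\<omega>. (cmod (log_sum (\<lambda>n. f n \<omega>) (2 ^ j\<^sup>2)))\<^sup>2 \<partial>M) / (harm (2 ^ j\<^sup>2))\<^sup>2"
        unfolding eq by (simp add: abs_of_nonneg)
      also have "\<dots> \<le> 4 * C * harm (2 ^ j\<^sup>2) / (harm (2 ^ j\<^sup>2))\<^sup>2"
        by (intro divide_right_mono second) auto
      also have "\<dots> = 4 * C / harm (2 ^ j\<^sup>2)" using h pos by (simp add: power2_eq_square)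
      also have "\<dots> \<le> 4 * C / (real j ^ 2 * ln 2)" using h pos C by (intro divide_left_mono) auto
      also have "\<dots> = 4 * C / ln 2 * inverse (real j ^ 2)" by (simp add: field_simps)
      finally show ?thesis .
    qed
    show "summable (\<lambda>j. \<integral>\<omega>. (cmod (log_mean (\<lambda>n. f n \<omega>) (2 ^ j\<^sup>2)))\<^sup>2 \<partial>M)"
      by (rule summable_comparison_test[OF _ summable_mult[OF inverse_power_summable[of 2, OF order_refl], of "4 * C / ln 2"]])
         (intro exI[of _ 1] allI impI le)
  qed simp
  then show ?thesis
  proof eventually_elim
    case (elim \<omega>)
    have "(\<lambda>j. sqrt ((cmod (log_mean (\<lambda>n. f n \<omega>) (2 ^ j\<^sup>2)))\<^sup>2)) \<longlonglongrightarrow> sqrt 0"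
      by (rule tendsto_real_sqrt[OF elim])
    then have "(\<lambda>j. log_mean (\<lambda>n. f n \<omega>) (2 ^ j\<^sup>2)) \<longlonglongrightarrow> 0"
      by (simp add: tendsto_norm_zero_iff)
    then show ?case by (rule log_mean_interpolation[OF B])
  qed
qed

section \<open>From logarithmic means to distribution functions\<close>

lemma harm_div_ln_tendsto: "(\<lambda>K. harm K / ln (real K)) \<longlonglongrightarrow> 1"
proof -
  have "filterlim (\<lambda>K. ln (real K)) at_top sequentially"
    by (rule filterlim_compose[OF ln_at_top filterlim_real_sequentially])
  then have "(\<lambda>K. (harm K - ln (real K)) / ln (real K)) \<longlonglongrightarrow> 0"
    by (rule real_tendsto_divide_at_top[OF euler_mascheroni_LIMSEQ])
  then have "(\<lambda>K. (harm K - ln (real K)) / ln (real K) + 1) \<longlonglongrightarrow> 0 + 1"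
    by (intro tendsto_add tendsto_const)
  moreover have "\<forall>\<^sub>F K in sequentially. (harm K - ln (real K)) / ln (real K) + 1 = harm K / ln (real K)"
    using eventually_gt_at_top[of 1] by eventually_elim (simp add: diff_divide_distrib)
  ultimately show ?thesis by (simp add: filterlim_cong)
qed

text \<open>The probability measures whose characteristic and distribution functions are the logarithmic
  means; the index is shifted because the mean of length \<open>0\<close> is \<open>0\<close>.\<close>

definition log_measure :: "(nat \<Rightarrow> real) \<Rightarrow> nat \<Rightarrow> real measure" where
  "log_measure I K = distr (point_measure {1..Suc K} (\<lambda>n. ennreal (inverse (real n) / harm (Suc K)))) borel I"

lemma log_measure_facts:
  shows real_distribution_log_measure: "real_distribution (log_measure I K)"
    and char_log_measure: "char (log_measure I K) t = log_mean (\<lambda>n. iexp (t * I n)) (Suc K)"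
    and cdf_log_measure: "cdf (log_measure I K) x = log_mean (\<lambda>n. indicator {..x} (I n)) (Suc K)"
proof -
  let ?w = "\<lambda>n. inverse (real n) / harm (Suc K)"
  let ?P = "point_measure {1..Suc K} (\<lambda>n. ennreal (?w n))"
  have h: "0 < (harm (Suc K) :: real)" by simp
  have w: "0 \<le> ?w n" for n by (intro divide_nonneg_nonneg) (auto simp: harm_nonneg)
  have "emeasure ?P {1..Suc K} = (\<Sum>n=1..Suc K. ennreal (?w n))"
    by (rule emeasure_point_measure_finite) auto
  also have "\<dots> = ennreal (\<Sum>n=1..Suc K. ?w n)" by (rule sum_ennreal) (rule w)
  also have "(\<Sum>n=1..Suc K. ?w n) = 1"
    unfolding sum_divide_distrib[symmetric] harm_real[symmetric] using h by (intro divide_self) linarith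
  finally interpret P: prob_space ?P
    by (intro prob_spaceI) (simp add: space_point_measure)
  have [measurable]: "I \<in> borel_measurable ?P" by simp
  show "real_distribution (log_measure I K)"
    unfolding log_measure_def by (rule P.real_distribution_distr) simp
  have val: "integral\<^sup>L ?P g = log_mean g (Suc K)" for g :: "nat \<Rightarrow> 'b::{banach, second_countable_topology}"
    by (subst lebesgue_integral_point_measure_finite)
       (use w in \<open>auto simp: log_mean_def log_sum_def scaleR_sum_right divide_inverse mult.commute simp del: sum.cl_ivl_Suc\<close>)
  have "char (log_measure I K) t = (CLINT n|?P. iexp (t * I n))"
    unfolding log_measure_def char_def by (rule integral_distr) auto
  then show "char (log_measure I K) t = log_mean (\<lambda>n. iexp (t * I n)) (Suc K)" by (simp only: val)
  have "cdf (log_measure I K) x = measure ?P (I -` {..x} \<inter> space ?P)"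
    unfolding log_measure_def cdf_def by (rule measure_distr) auto
  also have "\<dots> = (\<integral>n. indicator (I -` {..x} \<inter> space ?P) n \<partial>?P)"
    by (simp add: Int_assoc)
  also have "\<dots> = (\<integral>n. indicator {..x} (I n) \<partial>?P)"
    by (rule Bochner_Integration.integral_cong) (auto simp: indicator_def)
  also have "\<dots> = log_mean (\<lambda>n. indicator {..x} (I n)) (Suc K)" by (rule val)
  finally show "cdf (log_measure I K) x = log_mean (\<lambda>n. indicator {..x} (I n)) (Suc K)" .
qed

text \<open>A deterministic statement about a single sequence \<open>I\<close>, to be applied
  outcome by outcome. Both kinds of means belong to \<open>log_measure I\<close>, so Levy's
  continuity theorem turns convergence of the one into convergence of the other at a point without
  mass.\<close>

lemma log_mean_indicator_tendsto:
  assumes M': "real_distribution M'" and atom: "measure M' {x} = 0"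
    and conv: "AE t in lborel. log_mean (\<lambda>n. iexp (t * I n)) \<longlonglongrightarrow> char M' t"
  shows "(\<lambda>K. (1 / ln (real K)) * (\<Sum>n=1..K. (1 / real n) * indicator {..x} (I n))) \<longlonglongrightarrow> cdf M' x"
proof -
  interpret M': real_distribution M' by (rule M')
  have "AE t in lborel. (\<lambda>K. char (log_measure I K) t) \<longlonglongrightarrow> char M' t"
    using conv unfolding char_log_measure by eventually_elim (rule LIMSEQ_Suc)
  then have "weak_conv_m (log_measure I) M'"
    by (intro levy_continuity real_distribution_log_measure M' char_tendsto_of_AE)
  then have "(\<lambda>K. cdf (log_measure I K) x) \<longlonglongrightarrow> cdf M' x"
    unfolding weak_conv_m_def weak_conv_def using atom M'.isCont_cdf by blast
  then have "log_mean (\<lambda>n. indicator {..x} (I n)) \<longlonglongrightarrow> cdf M' x"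
    unfolding cdf_log_measure by (rule LIMSEQ_imp_Suc)
  from tendsto_mult[OF harm_div_ln_tendsto this]
  have "(\<lambda>K. harm K / ln (real K) * log_mean (\<lambda>n. indicator {..x} (I n)) K) \<longlonglongrightarrow> cdf M' x" by simp
  moreover have "harm K / ln (real K) * log_mean (\<lambda>n. indicator {..x} (I n)) K
    = (1 / ln (real K)) * (\<Sum>n=1..K. (1 / real n) * indicator {..x} (I n))" for K
  \<comment> \<open>Only K = 0 needs a case, because \<open>harm 0 = 0\<close>; at K = 1 both sides
    are 0, division by \<open>ln 1\<close> giving 0.\<close>
  proof (cases "K = 0")
    case False
    then have "(harm K :: real) \<noteq> 0" using harm_pos[of K, where 'a = real] by linarith
    then show ?thesis by (simp add: log_mean_def log_sum_def divide_inverse)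
  qed (simp add: log_mean_def log_sum_def)
  ultimately show ?thesis by (simp only:)
qed

lemma log_mean_diff: "log_mean (\<lambda>n. f n - g n) K = log_mean f K - log_mean g K"
  by (simp add: log_mean_def log_sum_def scaleR_right_diff_distrib sum_subtractf)

subsection \<open>Stable sums with random weights\<close>

lemma exp_minus_lipschitz:
  fixes x y :: real
  assumes "0 \<le> x" "0 \<le> y"
  shows "\<bar>exp (- x) - exp (- y)\<bar> \<le> \<bar>x - y\<bar>"
proof -
  have *: "exp (- a) - exp (- b) \<le> b - a" if "0 \<le> a" "a \<le> b" for a b :: real
  proof -
    have "exp (- a) - exp (- b) = exp (- a) * (1 - exp (- (b - a)))"
      by (simp add: algebra_simps flip: exp_add)
    also have "\<dots> \<le> 1 * (1 - exp (- (b - a)))"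
      using that by (intro mult_right_mono) auto
    also have "\<dots> \<le> b - a" unfolding mult_1 using exp_ge_add_one_self[of "- (b - a)"] by linarith
    finally show ?thesis .
  qed
  show ?thesis using *[of x y] *[of y x] assms
    by (cases "x \<le> y") (auto simp: abs_if)
qed

text \<open>The stable scale parameters of \<open>I\<^sub>n - I\<^sub>m\<close> and of independent copies of \<open>I\<^sub>n\<close>, \<open>I\<^sub>m\<close> differ
  by this much, relative to the scale of \<open>I\<^sub>n\<close>.\<close>

lemma stable_scale_gap:
  fixes p :: real and n m :: nat
  assumes p: "1 < p" "p < 2" and nm: "1 \<le> n" "n \<le> m"
  defines "a \<equiv> 1 / real n powr (1 / p)" and "b \<equiv> 1 / real m powr (1 / p)"
  shows "\<bar>real n * \<bar>a - b\<bar> powr p - real n / real m - 1\<bar> \<le> 3 * sqrt (real n / real m)"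
proof -
  \<comment> \<open>This is the ratio b / a, which turns the first term of the claim into
    \<open>(1 - x) powr p\<close>.\<close>
  define x where "x = (real n / real m) powr (1 / p)"
  have r: "0 < real n / real m" "real n / real m \<le> 1" using nm by auto
  have x: "0 < x" "x \<le> 1" using r nm p unfolding x_def by (auto intro!: powr_le1)
  have xp: "x powr p = real n / real m" using r nm p by (simp add: x_def powr_powr)
  have ap: "a powr p = 1 / real n" using nm p by (simp add: a_def powr_divide powr_powr)
  have ab: "\<bar>a - b\<bar> = a * (1 - x)"
  proof -
    have "b = a * x" using nm by (simp add: a_def b_def x_def powr_divide)
    moreover have "0 < a" using nm by (simp add: a_def)
    ultimately show ?thesis using x by (simp add: abs_mult algebra_simps abs_of_nonneg)
  qed
  have "real n * \<bar>a - b\<bar> powr p = real n * (a powr p * (1 - x) powr p)"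
    using x nm unfolding ab by (subst powr_mult) (auto simp: a_def)
  then have main: "real n * \<bar>a - b\<bar> powr p = (1 - x) powr p" using ap nm by simp
  \<comment> \<open>Since 1 - x lies in [0, 1) and p < 2, its square is a lower bound for its p-th
    power.\<close>
  have "1 - 2 * x \<le> (1 - x)\<^sup>2" by (simp add: power2_eq_square algebra_simps)
  also have "\<dots> = (1 - x) powr 2" using x by (simp add: powr_numeral)
  also have "\<dots> \<le> (1 - x) powr p" using x p by (intro powr_mono') auto
  finally have lower: "1 - 2 * x \<le> (1 - x) powr p" .
  have upper: "(1 - x) powr p \<le> 1" using x p by (intro powr_le1) auto
  \<comment> \<open>The base is at most 1 and \<open>1 / p\<close> exceeds 1/2. Hence 2 x + n / m is
    at most three times the square root, which is the origin of the 3.\<close>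
  have xs: "x \<le> sqrt (real n / real m)"
    unfolding x_def powr_half_sqrt[OF less_imp_le[OF r(1)], symmetric]
    using r p by (intro powr_mono') (auto simp: field_simps)
  have rs: "real n / real m \<le> sqrt (real n / real m)"
  proof (rule real_le_rsqrt)
    have "(real n / real m)\<^sup>2 \<le> real n / real m * 1"
      unfolding power2_eq_square by (rule mult_left_mono) (use r in linarith)+
    then show "(real n / real m)\<^sup>2 \<le> real n / real m" by simp
  qed
  have "0 \<le> real n / real m" using r by simp
  then show ?thesis unfolding main using lower upper xs rs by linarith
qed

text \<open>What the limit theorem takes from the process: weights that are functions of a variable
  \<open>U\<close> independent of the noise, with a common p-th absolute moment and a law of large
  numbers. \<open>h_mean\<close> stands beside \<open>h_average\<close> because almost sure
  convergence does not control the expectations of the averages, which the covariance estimate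
  uses.\<close>

locale stable_weighted_sums = prob_space M for M :: "'a measure" +
  fixes p c :: real and Y :: "nat \<Rightarrow> 'a \<Rightarrow> real"
    and S :: "(nat \<Rightarrow> real) measure" and U :: "'a \<Rightarrow> nat \<Rightarrow> real" and h :: "nat \<Rightarrow> (nat \<Rightarrow> real) \<Rightarrow> real"
  assumes p: "1 < p" "p < 2"
    and Y_rv: "\<And>n. n \<ge> 1 \<Longrightarrow> Y n \<in> borel_measurable M"
    and Y_indep: "indep_vars (\<lambda>_. borel) Y {1..}"
    and Y_char: "\<And>n. n \<ge> 1 \<Longrightarrow> char (distr M borel (Y n)) = (\<lambda>t. complex_of_real (exp (- (\<bar>t\<bar> powr p))))"
    and YU_indep: "indep_var (PiM {1..} (\<lambda>_. borel)) (\<lambda>\<omega>. \<lambda>n\<in>{1::nat..}. Y n \<omega>) S U"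
    and h_meas[measurable]: "\<And>n. h n \<in> borel_measurable S"
    and h_int: "\<And>n. n \<ge> 1 \<Longrightarrow> integrable M (\<lambda>\<omega>. \<bar>h n (U \<omega>)\<bar> powr p)"
    and h_mean: "\<And>n. n \<ge> 1 \<Longrightarrow> expectation (\<lambda>\<omega>. \<bar>h n (U \<omega>)\<bar> powr p) = c"
    and h_average: "AE \<omega> in M. (\<lambda>n. (\<Sum>i=1..n. \<bar>h i (U \<omega>)\<bar> powr p) / real n) \<longlonglongrightarrow> c"
begin

definition avg :: "nat \<Rightarrow> (nat \<Rightarrow> real) \<Rightarrow> real" where
  "avg n u = (\<Sum>i=1..n. \<bar>h i u\<bar> powr p) / real n"

definition norm_sum :: "nat \<Rightarrow> 'a \<Rightarrow> real" where
  "norm_sum n \<omega> = (1 / real n powr (1 / p)) * (\<Sum>i=1..n. h i (U \<omega>) * Y i \<omega>)"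

lemma U_meas[measurable]: "U \<in> measurable M S"
  using YU_indep by (rule indep_var_rv2)

lemma avg_meas[measurable]: "avg n \<in> borel_measurable S"
  unfolding avg_def by measurable

lemma avg_nonneg: "0 \<le> avg n u"
  unfolding avg_def by (intro divide_nonneg_nonneg sum_nonneg) auto

lemma norm_sum_meas[measurable]: "norm_sum n \<in> borel_measurable M"
  unfolding norm_sum_def
  by (intro borel_measurable_times borel_measurable_const borel_measurable_sum Y_rv) auto

lemma char_fixed_weights:
  "(CLINT \<omega>|M. iexp (\<Sum>i=1..m. a i * Y i \<omega>)) = complex_of_real (exp (- (\<Sum>i=1..m. \<bar>a i\<bar> powr p)))"
proof -
  have ind: "indep_vars (\<lambda>_. borel) (\<lambda>i \<omega>. a i * Y i \<omega>) {1..m}"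
    by (rule indep_vars_compose2[OF indep_vars_subset[OF Y_indep]]) auto
  have [measurable]: "Y i \<in> borel_measurable M" if "i \<in> {1..m}" for i using that by (intro Y_rv) auto
  have "(CLINT \<omega>|M. iexp (\<Sum>i=1..m. a i * Y i \<omega>)) = char (distr M borel (\<lambda>\<omega>. \<Sum>i=1..m. a i * Y i \<omega>)) 1"
    unfolding char_def by (subst integral_distr) auto
  also have "\<dots> = (\<Prod>i=1..m. char (distr M borel (\<lambda>\<omega>. a i * Y i \<omega>)) 1)"
    by (rule char_distr_sum[OF ind])
  also have "\<dots> = (\<Prod>i=1..m. complex_of_real (exp (- (\<bar>a i\<bar> powr p))))"
  proof (rule prod.cong[OF refl])
    fix i assume i: "i \<in> {1..m}"
    then have [measurable]: "Y i \<in> borel_measurable M" by (intro Y_rv) auto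
    have "char (distr M borel (\<lambda>\<omega>. a i * Y i \<omega>)) 1 = char (distr M borel (Y i)) (a i)"
      unfolding char_def by (simp add: integral_distr)
    then show "char (distr M borel (\<lambda>\<omega>. a i * Y i \<omega>)) 1 = complex_of_real (exp (- (\<bar>a i\<bar> powr p)))"
      using Y_char[of i] i by simp
  qed
  also have "\<dots> = complex_of_real (exp (- (\<Sum>i=1..m. \<bar>a i\<bar> powr p)))"
    by (simp only: of_real_prod[symmetric] exp_sum[OF finite_atLeastAtMost, symmetric] sum_negf)
  finally show ?thesis .
qed

text \<open>Conditionally on \<open>U\<close>, a linear combination of the \<open>Y i\<close> with \<open>U\<close>-measurable coefficients is
  symmetric stable.\<close>

lemma char_random_weights:
  assumes a[measurable]: "\<And>i. a i \<in> borel_measurable S" and V[measurable]: "V \<in> borel_measurable S"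
    and V_bd: "\<And>u. \<bar>V u\<bar> \<le> 1"
  shows "(CLINT \<omega>|M. iexp (\<Sum>i=1..m. a i (U \<omega>) * Y i \<omega>) * complex_of_real (V (U \<omega>)))
    = complex_of_real (\<integral>\<omega>. exp (- (\<Sum>i=1..m. \<bar>a i (U \<omega>)\<bar> powr p)) * V (U \<omega>) \<partial>M)"
proof -
  define PY where "PY = PiM {1::nat..} (\<lambda>_. borel :: real measure)"
  define Z where "Z \<omega> = (\<lambda>n\<in>{1::nat..}. Y n \<omega>)" for \<omega>
  have Z[measurable]: "Z \<in> measurable M PY"
    using indep_var_rv1[OF YU_indep] by (simp add: PY_def Z_def[abs_def])
  \<comment> \<open>Independence enters as a product law, so that Fubini can integrate over the
    noise with the value u of \<open>U\<close> frozen.\<close>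
  have joint: "distr M PY Z \<Otimes>\<^sub>M distr M S U = distr M (PY \<Otimes>\<^sub>M S) (\<lambda>\<omega>. (Z \<omega>, U \<omega>))"
    using YU_indep unfolding indep_var_distribution_eq PY_def Z_def by auto
  \<comment> \<open>The bounded factor \<open>V\<close> serves the mixed terms of the covariance,
    where one exponential meets a function of \<open>U\<close>.\<close>
  define f where "f y u = iexp (\<Sum>i=1..m. a i u * y i) * complex_of_real (V u)" for y :: "nat \<Rightarrow> real" and u
  interpret Q1: prob_space "distr M PY Z" by (rule prob_space_distr) measurable
  interpret Q2: prob_space "distr M S U" by (rule prob_space_distr) measurable
  interpret Q: pair_prob_space "distr M PY Z" "distr M S U" ..
  have f_meas[measurable]: "case_prod f \<in> borel_measurable (PY \<Otimes>\<^sub>M S)"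
  proof -
    have fst_i: "(\<lambda>x. fst x i) \<in> borel_measurable (PY \<Otimes>\<^sub>M S)" if "i \<in> {1..m}" for i
      unfolding PY_def by (rule measurable_compose[OF measurable_fst measurable_component_singleton]) (use that in auto)
    have "(\<lambda>x. \<Sum>i=1..m. a i (snd x) * fst x i) \<in> borel_measurable (PY \<Otimes>\<^sub>M S)"
      by (intro borel_measurable_sum borel_measurable_times fst_i measurable_compose[OF measurable_snd a])
    then show ?thesis unfolding f_def case_prod_beta by measurable
  qed
  have f_bd: "cmod (f y u) \<le> 1" for y u
    using V_bd[of u] by (simp add: f_def norm_mult del: of_real_sum of_real_mult)
  have int_f: "integrable (distr M PY Z \<Otimes>\<^sub>M distr M S U) (case_prod f)"
    by (rule Q.integrable_const_bound[where B = 1]) (auto simp: f_bd split: prod.split)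
  have "(CLINT \<omega>|M. f (Z \<omega>) (U \<omega>)) = (CLINT x|distr M (PY \<Otimes>\<^sub>M S) (\<lambda>\<omega>. (Z \<omega>, U \<omega>)). case_prod f x)"
    by (subst integral_distr) auto
  also have "\<dots> = (CLINT u|distr M S U. (CLINT y|distr M PY Z. f y u))"
    unfolding joint[symmetric] by (rule Q.integral_snd[OF int_f, symmetric])
  also have "\<dots> = (CLINT u|distr M S U. complex_of_real (exp (- (\<Sum>i=1..m. \<bar>a i u\<bar> powr p)) * V u))"
  proof (rule Bochner_Integration.integral_cong[OF refl])
    fix u assume "u \<in> space (distr M S U)"
    then have u: "u \<in> space S" by simp
    have "(\<lambda>y. f y u) \<in> borel_measurable PY"
      using measurable_compose[OF measurable_Pair2'[OF u] f_meas] by simp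
    then have "(CLINT y|distr M PY Z. f y u) = (CLINT \<omega>|M. f (Z \<omega>) u)"
      by (intro integral_distr Z)
    also have "\<dots> = (CLINT \<omega>|M. iexp (\<Sum>i=1..m. a i u * Y i \<omega>)) * complex_of_real (V u)"
      by (simp add: f_def Z_def del: of_real_sum of_real_mult)
    finally show "(CLINT y|distr M PY Z. f y u) = complex_of_real (exp (- (\<Sum>i=1..m. \<bar>a i u\<bar> powr p)) * V u)"
      by (simp only: char_fixed_weights of_real_mult)
  qed
  also have "\<dots> = (CLINT \<omega>|M. complex_of_real (exp (- (\<Sum>i=1..m. \<bar>a i (U \<omega>)\<bar> powr p)) * V (U \<omega>)))"
    by (subst integral_distr) auto
  also have "\<dots> = complex_of_real (\<integral>\<omega>. exp (- (\<Sum>i=1..m. \<bar>a i (U \<omega>)\<bar> powr p)) * V (U \<omega>) \<partial>M)"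
    by (rule integral_complex_of_real)
  finally show ?thesis by (simp add: f_def Z_def del: of_real_sum of_real_mult)
qed

end

text \<open>All quantifiers are countable, which makes the set of convergence measurable, as the
  exchange of two almost everywhere quantifiers requires.\<close>

lemma LIMSEQ_iff_inverse_Suc:
  fixes f :: "nat \<Rightarrow> 'b::real_normed_vector"
  shows "f \<longlonglongrightarrow> l \<longleftrightarrow> (\<forall>k. \<exists>N. \<forall>n\<ge>N. norm (f n - l) < inverse (real (Suc k)))"
proof
  assume "f \<longlonglongrightarrow> l"
  then show "\<forall>k. \<exists>N. \<forall>n\<ge>N. norm (f n - l) < inverse (real (Suc k))"
    unfolding LIMSEQ_iff by simp
next
  assume R: "\<forall>k. \<exists>N. \<forall>n\<ge>N. norm (f n - l) < inverse (real (Suc k))"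
  show "f \<longlonglongrightarrow> l"
  proof (rule LIMSEQ_I)
    fix r :: real assume "0 < r"
    then obtain k where k: "inverse (real (Suc k)) < r" using reals_Archimedean by blast
    from R obtain N where "\<forall>n\<ge>N. norm (f n - l) < inverse (real (Suc k))" by blast
    then have "\<forall>n\<ge>N. norm (f n - l) < r" using k by (meson less_trans)
    then show "\<exists>no. \<forall>n\<ge>no. norm (f n - l) < r" by blast
  qed
qed

section \<open>Conditional characteristic functions and covariances\<close>

context stable_weighted_sums
begin

definition rate :: "nat \<Rightarrow> real" where
  "rate n = 1 / real n powr (1 / p)"

lemma rate_powr: "\<bar>rate n\<bar> powr p = 1 / real n"
  using p by (simp add: rate_def powr_divide powr_powr)

lemma norm_sum_alt: "t * norm_sum n \<omega> = (\<Sum>i=1..n. (t * rate n * h i (U \<omega>)) * Y i \<omega>)"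
  by (simp add: norm_sum_def rate_def sum_distrib_left mult.assoc)

lemma sum_rate_weights: "(\<Sum>i=1..n. \<bar>t * rate n * h i u\<bar> powr p) = \<bar>t\<bar> powr p * avg n u"
  by (simp add: abs_mult powr_mult rate_powr avg_def sum_distrib_left sum_divide_distrib)

definition cond_char :: "real \<Rightarrow> nat \<Rightarrow> (nat \<Rightarrow> real) \<Rightarrow> real" where
  "cond_char t n u = exp (- (\<bar>t\<bar> powr p * avg n u))"

lemma cond_char_meas[measurable]: "cond_char t n \<in> borel_measurable S"
  unfolding cond_char_def by measurable

lemma cond_char_bounds: "0 \<le> cond_char t n u" "cond_char t n u \<le> 1" "\<bar>cond_char t n u\<bar> \<le> 1"
  using avg_nonneg[of n u] by (auto simp: cond_char_def)

text \<open>Tested against all such \<open>V\<close>, this says that \<open>cond_char t n\<close> is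
  the conditional expectation of \<open>iexp (t * norm_sum n)\<close> given
  \<open>U\<close>.\<close>

lemma integral_iexp_norm_sum:
  assumes "V \<in> borel_measurable S" "\<And>u. \<bar>V u\<bar> \<le> 1"
  shows "(CLINT \<omega>|M. iexp (t * norm_sum n \<omega>) * complex_of_real (V (U \<omega>)))
    = complex_of_real (\<integral>\<omega>. cond_char t n (U \<omega>) * V (U \<omega>) \<partial>M)"
  unfolding norm_sum_alt cond_char_def sum_rate_weights[symmetric]
  by (rule char_random_weights[OF _ assms]) measurable

lemma cond_char_tendsto:
  "AE \<omega> in M. \<forall>t. (\<lambda>n. cond_char t n (U \<omega>)) \<longlonglongrightarrow> exp (- (\<bar>t\<bar> powr p * c))"
  using h_average
proof eventually_elim
  case (elim \<omega>)
  then show ?case unfolding cond_char_def avg_def[symmetric]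
    by (intro allI tendsto_exp tendsto_minus tendsto_mult tendsto_const)
qed

lemma char_norm_sum_tendsto:
  "(\<lambda>n. char (distr M borel (norm_sum n)) t) \<longlonglongrightarrow> complex_of_real (exp (- (\<bar>t\<bar> powr p * c)))"
proof -
  have "char (distr M borel (norm_sum n)) t = complex_of_real (\<integral>\<omega>. cond_char t n (U \<omega>) \<partial>M)" for n
    using integral_iexp_norm_sum[of "\<lambda>_. 1" t n] unfolding char_def by (subst integral_distr) auto
  moreover have "(\<lambda>n. \<integral>\<omega>. cond_char t n (U \<omega>) \<partial>M) \<longlonglongrightarrow> (\<integral>\<omega>. exp (- (\<bar>t\<bar> powr p * c)) \<partial>M)"
  proof (rule integral_dominated_convergence[where w = "\<lambda>_. 1"])
    show "AE \<omega> in M. (\<lambda>n. cond_char t n (U \<omega>)) \<longlonglongrightarrow> exp (- (\<bar>t\<bar> powr p * c))"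
      using cond_char_tendsto by eventually_elim blast
    show "AE \<omega> in M. norm (cond_char t n (U \<omega>)) \<le> 1" for n
      by (intro AE_I2) (simp add: cond_char_bounds)
  qed auto
  ultimately show ?thesis by (simp add: prob_space tendsto_of_real)
qed

lemma integral_avg:
  assumes n: "1 \<le> n"
  shows "integrable M (\<lambda>\<omega>. avg n (U \<omega>))" "(\<integral>\<omega>. avg n (U \<omega>) \<partial>M) = c"
proof -
  show "integrable M (\<lambda>\<omega>. avg n (U \<omega>))"
    unfolding avg_def by (intro integrable_divide Bochner_Integration.integrable_sum h_int) auto
  have "(\<integral>\<omega>. avg n (U \<omega>) \<partial>M) = (\<Sum>i=1..n. expectation (\<lambda>\<omega>. \<bar>h i (U \<omega>)\<bar> powr p)) / real n"
    unfolding avg_def by (subst integral_divide_zero, subst Bochner_Integration.integral_sum) (auto intro: h_int)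
  also have "\<dots> = c" using n by (simp add: h_mean)
  finally show "(\<integral>\<omega>. avg n (U \<omega>) \<partial>M) = c" .
qed

definition centred :: "real \<Rightarrow> nat \<Rightarrow> 'a \<Rightarrow> complex" where
  "centred t n \<omega> = iexp (t * norm_sum n \<omega>) - complex_of_real (cond_char t n (U \<omega>))"

lemma centred_meas[measurable]: "centred t n \<in> borel_measurable M"
  unfolding centred_def by measurable

lemma centred_bound: "cmod (centred t n \<omega>) \<le> 2"
proof -
  have "cmod (centred t n \<omega>) \<le> cmod (iexp (t * norm_sum n \<omega>)) + cmod (complex_of_real (cond_char t n (U \<omega>)))"
    unfolding centred_def by (rule norm_triangle_ineq4)
  also have "\<dots> \<le> 1 + 1"
    using cond_char_bounds(3)[of t n "U \<omega>"] by (intro add_mono) (simp_all del: of_real_mult)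
  finally show ?thesis by simp
qed

text \<open>\<open>w\<close> gives the coefficients of t times the difference of the n-th and m-th
  normalised sums: the first n summands occur in both, the others only in the second. Completing the
  tail to all i \<le> m produces \<open>avg m\<close>, at the price of the correction
  \<open>- n / m\<close> to the factor of \<open>avg n\<close>.\<close>

lemma difference_weights:
  fixes t :: real and n m :: nat
  assumes nm: "1 \<le> n" "n \<le> m"
  defines "w \<equiv> \<lambda>i. t * ((if i \<le> n then rate n else 0) - rate m)"
  shows "(\<Sum>i=1..m. \<bar>w i * h i u\<bar> powr p)
    = \<bar>t\<bar> powr p * (avg m u + (real n * \<bar>rate n - rate m\<bar> powr p - real n / real m) * avg n u)"
proof -
  let ?H = "\<lambda>i. \<bar>h i u\<bar> powr p"
  let ?A = "\<bar>rate n - rate m\<bar> powr p"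
  have "(\<Sum>i=1..m. \<bar>w i * h i u\<bar> powr p)
    = (\<Sum>i=1..m. \<bar>t\<bar> powr p * (1 / real m * ?H i + (if i \<le> n then (?A - 1 / real m) * ?H i else 0)))"
    by (intro sum.cong refl) (auto simp: w_def abs_mult powr_mult rate_powr left_diff_distrib[of _ _ "_ powr _"])
  also have "\<dots> = \<bar>t\<bar> powr p * ((\<Sum>i=1..m. 1 / real m * ?H i) + (\<Sum>i=1..m. if i \<le> n then (?A - 1 / real m) * ?H i else 0))"
    by (simp add: sum_distrib_left[symmetric] sum.distrib)
  also have "(\<Sum>i=1..m. if i \<le> n then (?A - 1 / real m) * ?H i else 0) = (\<Sum>i=1..n. (?A - 1 / real m) * ?H i)"
    using nm by (intro sum.mono_neutral_cong_right) auto
  also have "\<dots> = (?A - 1 / real m) * (real n * avg n u)"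
  proof -
    have "real n * avg n u = (\<Sum>i=1..n. ?H i)" using nm by (simp add: avg_def)
    then show ?thesis by (simp only: sum_distrib_left)
  qed
  also have "(\<Sum>i=1..m. 1 / real m * ?H i) = avg m u"
    by (simp add: avg_def sum_divide_distrib)
  finally show ?thesis by (simp add: algebra_simps)
qed

text \<open>Of the four terms of the product, the three that contain a conditional mean have the
  same expectation, with signs -, - and +. What remains is the expectation of a difference of two
  exponentials. In the difference of their exponents \<open>avg m\<close> cancels, leaving a small
  multiple of \<open>avg n\<close>, whose expectation is c.\<close>

lemma covariance_bound:
  assumes nm: "1 \<le> n" "n \<le> m"
  shows "cmod (CLINT \<omega>|M. centred t n \<omega> * cnj (centred t m \<omega>)) \<le> 3 * \<bar>t\<bar> powr p * c * sqrt (real n / real m)"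
proof -
  define w where "w i = t * ((if i \<le> n then rate n else 0) - rate m)" for i
  define D where "D u = (\<Sum>i=1..m. \<bar>w i * h i u\<bar> powr p)" for u
  have D[measurable]: "D \<in> borel_measurable S" unfolding D_def by measurable
  have D0: "0 \<le> D u" for u unfolding D_def by (intro sum_nonneg) auto
  let ?E = "\<lambda>n \<omega>. cond_char t n (U \<omega>)"
  let ?e = "\<lambda>n \<omega>. iexp (t * norm_sum n \<omega>)"
  \<comment> \<open>Both exponentials merge into one with coefficients \<open>w\<close>, so that
    \<open>char_random_weights\<close> evaluates the product exactly.\<close>
  have prod: "?e n \<omega> * cnj (?e m \<omega>) = iexp (\<Sum>i=1..m. (w i * h i (U \<omega>)) * Y i \<omega>)" for \<omega>
  proof -
    have "(\<Sum>i=1..m. (w i * h i (U \<omega>)) * Y i \<omega>)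
      = (\<Sum>i=1..m. if i \<le> n then t * rate n * h i (U \<omega>) * Y i \<omega> else 0) - (\<Sum>i=1..m. (t * rate m * h i (U \<omega>)) * Y i \<omega>)"
      unfolding sum_subtractf[symmetric] by (intro sum.cong refl) (simp add: w_def algebra_simps)
    also have "(\<Sum>i=1..m. if i \<le> n then t * rate n * h i (U \<omega>) * Y i \<omega> else 0)
      = (\<Sum>i=1..n. (t * rate n * h i (U \<omega>)) * Y i \<omega>)"
      using nm by (intro sum.mono_neutral_cong_right) auto
    finally have eq: "(\<Sum>i=1..m. (w i * h i (U \<omega>)) * Y i \<omega>) = t * norm_sum n \<omega> - t * norm_sum m \<omega>"
      by (simp only: norm_sum_alt)
    show ?thesis unfolding eq by (simp add: exp_cnj right_diff_distrib exp_diff exp_minus divide_inverse)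
  qed
  have cnj_e: "cnj (?e m \<omega>) = iexp ((- t) * norm_sum m \<omega>)" for \<omega>
    by (simp add: exp_cnj)
  have T1: "(CLINT \<omega>|M. ?e n \<omega> * cnj (?e m \<omega>)) = complex_of_real (\<integral>\<omega>. exp (- D (U \<omega>)) \<partial>M)"
    unfolding prod D_def using char_random_weights[of "\<lambda>i u. w i * h i u" "\<lambda>_. 1" m] by simp
  have T2: "(CLINT \<omega>|M. ?e n \<omega> * complex_of_real (?E m \<omega>)) = complex_of_real (\<integral>\<omega>. ?E n \<omega> * ?E m \<omega> \<partial>M)"
    by (rule integral_iexp_norm_sum[OF cond_char_meas cond_char_bounds(3)])
  \<comment> \<open>Conjugation replaces t by -t, and \<open>cond_char\<close> is even in t.\<close>
  have T3: "(CLINT \<omega>|M. cnj (?e m \<omega>) * complex_of_real (?E n \<omega>)) = complex_of_real (\<integral>\<omega>. ?E n \<omega> * ?E m \<omega> \<partial>M)"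
  proof -
    have "cond_char (- t) m = cond_char t m" by (simp add: cond_char_def fun_eq_iff)
    then show ?thesis
      unfolding cnj_e integral_iexp_norm_sum[OF cond_char_meas cond_char_bounds(3)] by (simp only: mult.commute)
  qed
  have T4: "(CLINT \<omega>|M. complex_of_real (?E n \<omega> * ?E m \<omega>)) = complex_of_real (\<integral>\<omega>. ?E n \<omega> * ?E m \<omega> \<partial>M)"
    by (rule integral_complex_of_real)
  have [measurable]: "cnj \<in> borel_measurable borel"
    by (intro borel_measurable_continuous_onI continuous_intros)
  have int: "integrable M (\<lambda>\<omega>. ?e n \<omega> * cnj (?e m \<omega>))" "integrable M (\<lambda>\<omega>. ?e n \<omega> * complex_of_real (?E m \<omega>))"
    "integrable M (\<lambda>\<omega>. cnj (?e m \<omega>) * complex_of_real (?E n \<omega>))" "integrable M (\<lambda>\<omega>. complex_of_real (?E n \<omega> * ?E m \<omega>))"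
    by (rule integrable_const_bound[where B = 1];
        simp add: norm_mult cond_char_bounds mult_le_one del: of_real_mult; fail)
       (rule integrable_const_bound[where B = 1];
        simp add: norm_mult cond_char_bounds abs_mult mult_le_one)+
  have iE: "integrable M (\<lambda>\<omega>. ?E n \<omega> * ?E m \<omega>)"
    by (rule integrable_const_bound[where B = 1]) (auto simp: cond_char_bounds abs_mult intro!: mult_le_one)
  have iD: "integrable M (\<lambda>\<omega>. exp (- D (U \<omega>)))"
    by (rule integrable_const_bound[where B = 1]) (auto simp: D0)
  have "(CLINT \<omega>|M. centred t n \<omega> * cnj (centred t m \<omega>))
    = (CLINT \<omega>|M. ?e n \<omega> * cnj (?e m \<omega>) - ?e n \<omega> * complex_of_real (?E m \<omega>)
        - cnj (?e m \<omega>) * complex_of_real (?E n \<omega>) + complex_of_real (?E n \<omega> * ?E m \<omega>))"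
    by (rule Bochner_Integration.integral_cong) (auto simp: centred_def algebra_simps)
  also have "\<dots> = (CLINT \<omega>|M. ?e n \<omega> * cnj (?e m \<omega>)) - (CLINT \<omega>|M. ?e n \<omega> * complex_of_real (?E m \<omega>))
      - (CLINT \<omega>|M. cnj (?e m \<omega>) * complex_of_real (?E n \<omega>)) + (CLINT \<omega>|M. complex_of_real (?E n \<omega> * ?E m \<omega>))"
    by (simp only: int Bochner_Integration.integral_add Bochner_Integration.integral_diff
        Bochner_Integration.integrable_add Bochner_Integration.integrable_diff)
  also have "\<dots> = complex_of_real ((\<integral>\<omega>. exp (- D (U \<omega>)) \<partial>M) - (\<integral>\<omega>. ?E n \<omega> * ?E m \<omega> \<partial>M))"
    unfolding T1 T2 T3 T4 by simp
  also have "\<dots> = complex_of_real (\<integral>\<omega>. exp (- D (U \<omega>)) - ?E n \<omega> * ?E m \<omega> \<partial>M)"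
    by (simp only: Bochner_Integration.integral_diff[OF iD iE])
  finally have cov: "(CLINT \<omega>|M. centred t n \<omega> * cnj (centred t m \<omega>))
    = complex_of_real (\<integral>\<omega>. exp (- D (U \<omega>)) - ?E n \<omega> * ?E m \<omega> \<partial>M)" .
  have "cmod (CLINT \<omega>|M. centred t n \<omega> * cnj (centred t m \<omega>))
    \<le> (\<integral>\<omega>. \<bar>exp (- D (U \<omega>)) - ?E n \<omega> * ?E m \<omega>\<bar> \<partial>M)"
    unfolding cov norm_of_real by (rule integral_abs_bound)
  also have "\<dots> \<le> (\<integral>\<omega>. 3 * \<bar>t\<bar> powr p * sqrt (real n / real m) * avg n (U \<omega>) \<partial>M)"
  proof (rule integral_mono)
    show "integrable M (\<lambda>\<omega>. \<bar>exp (- D (U \<omega>)) - ?E n \<omega> * ?E m \<omega>\<bar>)"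
      by (rule integrable_abs[OF Bochner_Integration.integrable_diff[OF iD iE]])
    show "integrable M (\<lambda>\<omega>. 3 * \<bar>t\<bar> powr p * sqrt (real n / real m) * avg n (U \<omega>))"
      by (rule integrable_mult_right) (rule integral_avg(1)[OF nm(1)])
  next
    fix \<omega>
    let ?u = "U \<omega>"
    let ?q = "\<bar>t\<bar> powr p"
    have "?E n \<omega> * ?E m \<omega> = exp (- (?q * (avg n ?u + avg m ?u)))"
      unfolding cond_char_def exp_add[symmetric] by (simp add: distrib_left)
    then have "\<bar>exp (- D ?u) - ?E n \<omega> * ?E m \<omega>\<bar> \<le> \<bar>D ?u - ?q * (avg n ?u + avg m ?u)\<bar>"
      using exp_minus_lipschitz[OF D0[of ?u], of "?q * (avg n ?u + avg m ?u)"] avg_nonneg[of n ?u] avg_nonneg[of m ?u]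
      by simp
    also have "D ?u - ?q * (avg n ?u + avg m ?u)
      = (?q * avg n ?u) * (real n * \<bar>rate n - rate m\<bar> powr p - real n / real m - 1)"
      unfolding D_def w_def difference_weights[OF nm] by (simp add: algebra_simps)
    also have "\<bar>\<dots>\<bar> = (?q * avg n ?u) * \<bar>real n * \<bar>rate n - rate m\<bar> powr p - real n / real m - 1\<bar>"
      using avg_nonneg[of n ?u] by (simp add: abs_mult)
    also have "\<dots> \<le> (?q * avg n ?u) * (3 * sqrt (real n / real m))"
      unfolding rate_def using stable_scale_gap[OF p nm] avg_nonneg[of n ?u] by (intro mult_left_mono) auto
    finally show "\<bar>exp (- D ?u) - ?E n \<omega> * ?E m \<omega>\<bar> \<le> 3 * ?q * sqrt (real n / real m) * avg n ?u"
      by (simp add: mult_ac)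
  qed
  also have "\<dots> = 3 * \<bar>t\<bar> powr p * c * sqrt (real n / real m)"
    using integral_avg(2)[OF nm(1)] by simp
  finally show ?thesis .
qed

lemma c_nonneg: "0 \<le> c"
proof -
  have "0 \<le> expectation (\<lambda>\<omega>. \<bar>h 1 (U \<omega>)\<bar> powr p)" by (intro integral_nonneg_AE) auto
  then show ?thesis unfolding h_mean[OF order_refl] .
qed

lemma log_mean_iexp_tendsto:
  "AE \<omega> in M. log_mean (\<lambda>n. iexp (t * norm_sum n \<omega>)) \<longlonglongrightarrow> complex_of_real (exp (- (\<bar>t\<bar> powr p * c)))"
proof -
  have "AE \<omega> in M. log_mean (\<lambda>n. centred t n \<omega>) \<longlonglongrightarrow> 0"
    by (rule log_mean_tendsto_zero_AE[where B = 2 and C = "3 * \<bar>t\<bar> powr p * c"])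
       (use centred_bound c_nonneg covariance_bound in auto)
  with cond_char_tendsto show ?thesis
  proof eventually_elim
    case (elim \<omega>)
    from elim(1) have "log_mean (\<lambda>n. complex_of_real (cond_char t n (U \<omega>))) \<longlonglongrightarrow> complex_of_real (exp (- (\<bar>t\<bar> powr p * c)))"
      by (intro log_mean_tendsto tendsto_of_real) blast
    from tendsto_add[OF this elim(2)] show ?case
      by (simp add: centred_def[abs_def] log_mean_diff)
  qed
qed

text \<open>The exceptional event of \<open>log_mean_iexp_tendsto\<close> depends on t, and the t
  are uncountable; the joint measurability of the convergence set allows the two quantifiers to be
  exchanged.\<close>

lemma log_mean_iexp_AE_AE:
  "AE \<omega> in M. AE t in lborel. log_mean (\<lambda>n. iexp (t * norm_sum n \<omega>)) \<longlonglongrightarrow> complex_of_real (exp (- (\<bar>t\<bar> powr p * c)))"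
proof -
  interpret P: pair_sigma_finite M "lborel :: real measure" ..
  define L where "L t = complex_of_real (exp (- (\<bar>t\<bar> powr p * c)))" for t
  define G where "G K \<omega> t = log_mean (\<lambda>n. iexp (t * norm_sum n \<omega>)) K" for K \<omega> t
  have [measurable]: "(\<lambda>x. L (snd x)) \<in> borel_measurable (M \<Otimes>\<^sub>M lborel)"
    unfolding L_def by measurable
  have [measurable]: "(\<lambda>x. G K (fst x) (snd x)) \<in> borel_measurable (M \<Otimes>\<^sub>M lborel)" for K
    unfolding G_def log_mean_def log_sum_def by measurable
  have "{x \<in> space (M \<Otimes>\<^sub>M lborel). (\<lambda>K. G K (fst x) (snd x)) \<longlonglongrightarrow> L (snd x)} \<in> sets (M \<Otimes>\<^sub>M lborel)"
    unfolding LIMSEQ_iff_inverse_Suc by measurable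
  from P.AE_commute[OF this] show ?thesis
    using log_mean_iexp_tendsto by (simp add: G_def L_def)
qed

theorem weak_and_almost_sure_limit:
  assumes M': "real_distribution M'" and char: "\<And>t. char M' t = complex_of_real (exp (- (\<bar>t\<bar> powr p * c)))"
    and c: "0 < c"
  shows "weak_conv_m (\<lambda>n. distr M borel (norm_sum n)) M'"
    "AE \<omega> in M. (\<lambda>K. (1 / ln (real K)) * (\<Sum>n=1..K. (1 / real n) * indicator {..x} (norm_sum n \<omega>)))
      \<longlonglongrightarrow> cdf M' x"
proof -
  interpret M': real_distribution M' by (rule M')
  show "weak_conv_m (\<lambda>n. distr M borel (norm_sum n)) M'"
    by (rule levy_continuity) (use char_norm_sum_tendsto in \<open>auto simp: char M'\<close>)
  have "integrable lborel (char M')"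
    unfolding char[abs_def] using integrable_exp_abs_powr[OF c, of p] p
    by (simp add: mult.commute complex_of_real_integrable_eq)
  then have atom: "measure M' {x} = 0" by (rule M'.no_atom_of_integrable_char)
  show "AE \<omega> in M. (\<lambda>K. (1 / ln (real K)) * (\<Sum>n=1..K. (1 / real n) * indicator {..x} (norm_sum n \<omega>)))
      \<longlonglongrightarrow> cdf M' x"
    using log_mean_iexp_AE_AE
    by eventually_elim (rule log_mean_indicator_tendsto[OF M' atom], simp only: char)
qed

end

subsection \<open>The GARCH process\<close>

lemma (in cdf_distribution) distr_quantile:
  "distr (restrict_space lborel {0<..<1}) borel (quantile (cdf M)) = M"
  using distr_I_eq_M unfolding quantile_def[abs_def] .

text \<open>On the open unit interval the quantile function is a variable with law \<open>M\<close>.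
  At 0 and 1 it is the infimum of a set that may be unbounded below or empty, so these endpoints are
  removed as a null set before the change of variables.\<close>

lemma (in cdf_distribution) quantile_transform:
  fixes f :: "real \<Rightarrow> real"
  assumes [measurable]: "f \<in> borel_measurable borel"
    and int: "set_integrable lborel {0..1} (\<lambda>u. f (quantile (cdf M) u))"
  shows "integrable M f" "(\<integral>x. f x \<partial>M) = (LBINT u:{0..1}. f (quantile (cdf M) u))"
proof -
  let ?Q = "quantile (cdf M)"
  have Q: "?Q \<in> borel_measurable (restrict_space lborel {0<..<1})"
    using measurable_CI unfolding quantile_def[abs_def] by (simp cong: measurable_cong_sets)
  have ae: "AE u in lborel. u \<noteq> (0::real) \<and> u \<noteq> 1"
    using AE_lborel_singleton[of "0::real"] AE_lborel_singleton[of "1::real"] by eventually_elim simp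
  have Qf: "(\<lambda>u. indicator {0<..<1} u *\<^sub>R f (?Q u)) \<in> borel_measurable lborel"
    using measurable_compose[OF Q assms(1)] by (subst (asm) borel_measurable_restrict_space_iff) auto
  have int01: "integrable lborel (\<lambda>u. indicator {0..1} u *\<^sub>R f (?Q u))"
    using int by (simp add: set_integrable_def)
  have eq: "AE u in lborel. indicator {0..1} u *\<^sub>R f (?Q u) = indicator {0<..<1} u *\<^sub>R f (?Q u)"
    using ae by eventually_elim (auto simp: indicator_def)
  have "integrable lborel (\<lambda>u. indicator {0<..<1} u *\<^sub>R f (?Q u))"
    using integrable_cong_AE[OF borel_measurable_integrable[OF int01] Qf eq] int01 by simp
  then have "integrable (restrict_space lborel {0<..<1}) (\<lambda>u. f (?Q u))"
    by (subst integrable_restrict_space) auto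
  then have "integrable (distr (restrict_space lborel {0<..<1}) borel ?Q) f"
    by (subst integrable_distr_eq[OF Q]) auto
  then show "integrable M f" unfolding distr_quantile .
  have "(\<integral>x. f x \<partial>M) = (\<integral>x. f x \<partial>distr (restrict_space lborel {0<..<1}) borel ?Q)"
    unfolding distr_quantile ..
  also have "\<dots> = (\<integral>u. f (?Q u) \<partial>restrict_space lborel {0<..<1})"
    by (rule integral_distr[OF Q]) simp
  also have "\<dots> = (\<integral>u. indicator {0<..<1} u *\<^sub>R f (?Q u) \<partial>lborel)"
    by (rule integral_restrict_space) simp
  also have "\<dots> = (LBINT u:{0..1}. f (?Q u))"
    unfolding set_lebesgue_integral_def
    using integral_cong_AE[OF borel_measurable_integrable[OF int01] Qf eq] by simp
  finally show "(\<integral>x. f x \<partial>M) = (LBINT u:{0..1}. f (?Q u))" .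
qed

text \<open>The interval has finite measure, so \<open>1 + \<bar>g u\<bar> powr r\<close> is an
  integrable majorant.\<close>

lemma set_integrable_powr_mono:
  fixes g :: "real \<Rightarrow> real"
  assumes [measurable]: "g \<in> borel_measurable borel" and pr: "0 \<le> p" "p \<le> r"
    and int: "set_integrable lborel {0..1} (\<lambda>u. \<bar>g u\<bar> powr r)"
  shows "set_integrable lborel {0..1} (\<lambda>u. \<bar>g u\<bar> powr p)"
  unfolding set_integrable_def
proof (rule Bochner_Integration.integrable_bound)
  show "integrable lborel (\<lambda>u::real. indicator {0..1} u *\<^sub>R 1 + indicator {0..1} u *\<^sub>R \<bar>g u\<bar> powr r)"
    using int unfolding set_integrable_def by (intro Bochner_Integration.integrable_add) auto
  show "AE u in lborel. norm (indicator {0..1} u *\<^sub>R \<bar>g u\<bar> powr p)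
    \<le> norm (indicator {0..1} u *\<^sub>R 1 + indicator {0..1} u *\<^sub>R \<bar>g u\<bar> powr r)"
  proof (intro AE_I2)
    fix u
    have "\<bar>g u\<bar> powr p \<le> 1 + \<bar>g u\<bar> powr r"
    proof (cases "1 \<le> \<bar>g u\<bar>")
      case True
      then have "\<bar>g u\<bar> powr p \<le> \<bar>g u\<bar> powr r" using pr by (intro powr_mono) auto
      then show ?thesis by simp
    next
      case False
      then have "\<bar>g u\<bar> powr p \<le> 1" using pr by (intro powr_le1) auto
      then show ?thesis by (simp add: add_increasing2)
    qed
    then show "norm (indicator {0..1} u *\<^sub>R \<bar>g u\<bar> powr p)
      \<le> norm (indicator {0..1} u *\<^sub>R 1 + indicator {0..1} u *\<^sub>R \<bar>g u\<bar> powr r)"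
      by (auto simp: indicator_def)
  qed
qed measurable

section \<open>Stationary sequences and the shift\<close>

lemma (in prob_space) stationary_seq_distr:
  fixes Z :: "int \<Rightarrow> 'a \<Rightarrow> 'b::topological_space"
  assumes st: "stationary_seq M Z" and [measurable]: "\<And>n. Z n \<in> borel_measurable M"
    and f[measurable]: "f \<in> borel_measurable borel"
  shows "distr M borel (\<lambda>\<omega>. f (Z n \<omega>)) = distr M borel (\<lambda>\<omega>. f (Z 0 \<omega>))"
proof -
  let ?B = "PiM UNIV (\<lambda>_::int. borel :: 'b measure)"
  have [measurable]: "(\<lambda>\<omega> m. Z (m + k) \<omega>) \<in> measurable M ?B" for k
    by (rule measurable_PiM_single') auto
  have [measurable]: "(\<lambda>\<omega> m. Z m \<omega>) \<in> measurable M ?B"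
    by (rule measurable_PiM_single') auto
  have [measurable]: "(\<lambda>z. f (z 0)) \<in> borel_measurable ?B" by measurable
  have "distr (distr M ?B (\<lambda>\<omega> m. Z (m + n) \<omega>)) borel (\<lambda>z. f (z 0))
      = distr (distr M ?B (\<lambda>\<omega> m. Z (m + 0) \<omega>)) borel (\<lambda>z. f (z 0))"
    using st by (simp add: stationary_seq_def)
  then show ?thesis by (simp add: distr_distr comp_def)
qed

text \<open>The sequence is replaced by its law on path space: there the shift preserves the
  measure, and \<open>ergodic_seq\<close> is the triviality of its invariant sets.\<close>

theorem (in prob_space) stationary_ergodic_average:
  fixes Z :: "int \<Rightarrow> 'a \<Rightarrow> 'b::topological_space"
  assumes st: "stationary_seq M Z" and er: "ergodic_seq M Z"
    and Z[measurable]: "\<And>n. Z n \<in> borel_measurable M"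
    and f[measurable]: "f \<in> borel_measurable borel" and int: "integrable M (\<lambda>\<omega>. f (Z 1 \<omega>))"
  shows "AE \<omega> in M. (\<lambda>n. (\<Sum>i=1..n. f (Z (int i) \<omega>)) / real n) \<longlonglongrightarrow> expectation (\<lambda>\<omega>. f (Z 1 \<omega>))"
proof -
  let ?B = "PiM UNIV (\<lambda>_::int. borel :: 'b measure)"
  let ?T = "\<lambda>(z :: int \<Rightarrow> 'b) n. z (n + 1)"
  \<comment> \<open>Coordinate 1 and not 0, because the iterates 0 to n - 1 of the shift must
    produce the indices 1 to n.\<close>
  let ?F = "\<lambda>z :: int \<Rightarrow> 'b. f (z 1)"
  define P where "P = distr M ?B (\<lambda>\<omega> n. Z n \<omega>)"
  have W[measurable]: "(\<lambda>\<omega> n. Z (n + k) \<omega>) \<in> measurable M ?B" for k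
    by (rule measurable_PiM_single') auto
  have W0[measurable]: "(\<lambda>\<omega> n. Z n \<omega>) \<in> measurable M ?B" using W[of 0] by simp
  have T: "?T \<in> measurable ?B ?B"
    by (rule measurable_PiM_single') auto
  have F: "?F \<in> borel_measurable ?B" by measurable
  interpret P: prob_space P unfolding P_def by (rule prob_space_distr) measurable
  have TP: "?T \<in> measurable P P" using T by (simp add: P_def cong: measurable_cong_sets)
  have "distr P P ?T = distr P ?B ?T" by (rule distr_cong) (auto simp: P_def)
  also have "\<dots> = distr M ?B (\<lambda>\<omega> n. Z (n + 1) \<omega>)"
    unfolding P_def by (subst distr_distr[OF T W0]) (simp add: comp_def)
  also have "\<dots> = P" using st by (simp add: stationary_seq_def P_def)
  finally have inv: "distr P P ?T = P" .
  have intP: "integrable P ?F" unfolding P_def by (subst integrable_distr_eq[OF W0 F]) (rule int)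
  have erg: "P.prob A = 0 \<or> P.prob A = 1" if "A \<in> sets P" "?T -` A \<inter> space P = A" for A
    using er that unfolding ergodic_seq_def Let_def P_def[symmetric] by blast
  have exp: "P.expectation ?F = expectation (\<lambda>\<omega>. f (Z 1 \<omega>))"
    unfolding P_def by (rule integral_distr[OF W0 F])
  have iter: "(?T ^^ i) z n = z (n + int i)" for i z n
    by (induction i arbitrary: n) (auto simp: algebra_simps)
  have sum: "birkhoff_sum ?T ?F n z = (\<Sum>i=1..n. f (z (int i)))" for n z
    unfolding birkhoff_sum_def iter by (simp add: sum.atLeast1_atMost_eq add.commute)
  have "AE z in P. (\<lambda>n. (\<Sum>i=1..n. f (z (int i))) / real n) \<longlonglongrightarrow> expectation (\<lambda>\<omega>. f (Z 1 \<omega>))"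
    using P.birkhoff_ergodic[OF TP inv intP erg] unfolding sum exp .
  then show ?thesis unfolding P_def by (rule AE_distrD[OF W0])
qed

theorem theorem4p2:
  fixes M :: "'a measure" and X \<sigma> \<xi> :: "int \<Rightarrow> 'a \<Rightarrow> real" and a0 a1 b1 :: real
    and Y :: "nat \<Rightarrow> 'a \<Rightarrow> real" and p r :: real
    and N :: "'b measure" and F :: "real \<Rightarrow> 'b measure" and Mo :: "real \<Rightarrow> 'b \<Rightarrow> real"
    and Z :: "'b \<Rightarrow> real"
  assumes garch: "garch11 M X \<sigma> \<xi> a0 a1 b1"
    and contF: "continuous_on UNIV (\<lambda>x. measure M {\<omega>\<in>space M. X 1 \<omega> \<le> x})"
    and p: "1 < p" "p < 2"
    and Y_rv: "\<And>n. n \<ge> 1 \<Longrightarrow> Y n \<in> borel_measurable M"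
    and Y_indep: "prob_space.indep_vars M (\<lambda>_. borel) Y {1..}"
    and Y_char: "\<And>n. n \<ge> 1 \<Longrightarrow>
                   char (distr M borel (Y n)) = (\<lambda>t. complex_of_real (exp (- (\<bar>t\<bar> powr p))))"
    and XY_indep: "prob_space.indep_var M
                     (PiM {1..} (\<lambda>_. borel)) (\<lambda>\<omega>. \<lambda>n\<in>{1::nat..}. Y n \<omega>)
                     (PiM UNIV (\<lambda>_. borel)) (\<lambda>\<omega> n. X n \<omega>)"
    and r: "r > p"
    and g_meas: "(\<lambda>u. (quantile (\<lambda>x. measure M {\<omega>\<in>space M. X 1 \<omega> \<le> x}) u)\<^sup>2
                    - (\<integral>\<omega>. (X 1 \<omega>)\<^sup>2 \<partial>M)) \<in> borel_measurable lborel"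
    and g_Lr: "set_integrable lborel {0..1} (\<lambda>u. \<bar>(quantile (\<lambda>x. measure M {\<omega>\<in>space M. X 1 \<omega> \<le> x}) u)\<^sup>2
                    - (\<integral>\<omega>. (X 1 \<omega>)\<^sup>2 \<partial>M)\<bar> powr r)"
    and Mo: "stable_motion p N F Mo"
    and Z: "stable_integral p N Mo
              (\<lambda>u. (quantile (\<lambda>x. measure M {\<omega>\<in>space M. X 1 \<omega> \<le> x}) u)\<^sup>2
                    - (\<integral>\<omega>. (X 1 \<omega>)\<^sup>2 \<partial>M)) Z"
  shows "weak_conv_m
           (\<lambda>n. distr M borel (\<lambda>\<omega>. (1 / real n powr (1 / p)) *
                 (\<Sum>i=1..n. ((X (int i) \<omega>)\<^sup>2 - (\<integral>\<omega>'. (X 1 \<omega>')\<^sup>2 \<partial>M)) * Y i \<omega>)))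
           (distr N borel Z) \<and>
         (\<forall>x. AE \<omega> in M.
           (\<lambda>K. (1 / ln (real K)) *
              (\<Sum>n=1..K. (1 / real n) *
                 indicator {\<omega>'. (1 / real n powr (1 / p)) *
                    (\<Sum>i=1..n. ((X (int i) \<omega>')\<^sup>2 - (\<integral>\<omega>''. (X 1 \<omega>'')\<^sup>2 \<partial>M)) * Y i \<omega>') \<le> x} \<omega>))
           \<longlonglongrightarrow> measure N {\<omega>\<in>space N. Z \<omega> \<le> x})"
proof -
  let ?F = "\<lambda>x. measure M {\<omega>\<in>space M. X 1 \<omega> \<le> x}"
  define c0 where "c0 = (\<integral>\<omega>. (X 1 \<omega>)\<^sup>2 \<partial>M)"
  define g where "g u = (quantile ?F u)\<^sup>2 - c0" for u
  define \<phi> where "\<phi> x = \<bar>x\<^sup>2 - c0\<bar> powr p" for x :: real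
  interpret prob_space M using garch by (simp add: garch11_def)
  have [measurable]: "\<sigma> n \<in> borel_measurable M" "\<xi> n \<in> borel_measurable M" for n
    using garch by (auto simp: garch11_def)
  have X_eq: "X n \<omega> = \<sigma> n \<omega> * \<xi> n \<omega>" if "\<omega> \<in> space M" for n \<omega>
    using garch that by (simp add: garch11_def)
  have X_meas[measurable]: "X n \<in> borel_measurable M" for n
    by (subst measurable_cong[OF X_eq]) measurable
  have \<phi>_meas[measurable]: "\<phi> \<in> borel_measurable borel" unfolding \<phi>_def by measurable
  \<comment> \<open>Stationarity and ergodicity are given for the pairs of volatility and noise;
    \<open>X\<close> enters as their product, an identity known only on
    \<open>space M\<close>.\<close>
  let ?Z = "\<lambda>n \<omega>. (\<sigma> n \<omega>, \<xi> n \<omega>)"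
  have st: "stationary_seq M ?Z" and er: "ergodic_seq M ?Z" using garch by (auto simp: garch11_def)
  have Z_meas: "?Z n \<in> borel_measurable M" for n by measurable
  have mult_meas: "(\<lambda>z::real \<times> real. fst z * snd z) \<in> borel_measurable borel"
    by (intro borel_measurable_continuous_onI continuous_intros)
  have distr_X: "distr M borel (X n) = distr M borel (X 1)" for n
  proof -
    have "distr M borel (X n) = distr M borel (\<lambda>\<omega>. fst (?Z n \<omega>) * snd (?Z n \<omega>))" for n
      by (rule distr_cong) (auto simp: X_eq)
    then show ?thesis
      using stationary_seq_distr[OF st Z_meas mult_meas, of n] stationary_seq_distr[OF st Z_meas mult_meas, of 1] by simp
  qed
  define \<mu> where "\<mu> = distr M borel (X 1)"
  interpret \<mu>: cdf_distribution \<mu>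
    unfolding \<mu>_def cdf_distribution_def by (rule real_distribution_distr) (rule X_meas)
  have cdf: "cdf \<mu> = ?F"
    unfolding \<mu>_def cdf_def by (auto simp: measure_distr vimage_def Int_def conj_commute intro!: ext)
  have g_borel: "g \<in> borel_measurable borel" using g_meas unfolding g_def c0_def by simp
  have "set_integrable lborel {0..1} (\<lambda>u. \<bar>g u\<bar> powr r)" using g_Lr unfolding g_def c0_def .
  from set_integrable_powr_mono[OF g_borel _ _ this, of p]
  have g_int: "set_integrable lborel {0..1} (\<lambda>u. \<bar>g u\<bar> powr p)" using p r by simp
  then have q_int: "set_integrable lborel {0..1} (\<lambda>u. \<phi> (quantile (cdf \<mu>) u))"
    unfolding cdf \<phi>_def g_def .
  define c where "c = (\<integral>x. \<phi> x \<partial>\<mu>)"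
  have c_g: "c = (LBINT u:{0..1}. \<bar>g u\<bar> powr p)"
    unfolding c_def \<mu>.quantile_transform(2)[OF \<phi>_meas q_int] cdf \<phi>_def g_def ..
  have \<phi>_int: "integrable M (\<lambda>\<omega>. \<phi> (X n \<omega>))" and \<phi>_mean: "(\<integral>\<omega>. \<phi> (X n \<omega>) \<partial>M) = c" for n
  proof -
    have "integrable (distr M borel (X n)) \<phi>"
      using \<mu>.quantile_transform(1)[OF \<phi>_meas q_int] unfolding distr_X[of n] \<mu>_def .
    then show "integrable M (\<lambda>\<omega>. \<phi> (X n \<omega>))" by (subst (asm) integrable_distr_eq) auto
    have "(\<integral>\<omega>. \<phi> (X n \<omega>) \<partial>M) = integral\<^sup>L (distr M borel (X n)) \<phi>"
      by (rule integral_distr[symmetric]) auto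
    then show "(\<integral>\<omega>. \<phi> (X n \<omega>) \<partial>M) = c" unfolding distr_X[of n] c_def \<mu>_def .
  qed
  have average: "AE \<omega> in M. (\<lambda>n. (\<Sum>i=1..n. \<phi> (X (int i) \<omega>)) / real n) \<longlonglongrightarrow> c"
  proof -
    let ?f = "\<lambda>z::real \<times> real. \<phi> (fst z * snd z)"
    have f: "?f \<in> borel_measurable borel" by (rule measurable_compose[OF mult_meas \<phi>_meas])
    have int: "integrable M (\<lambda>\<omega>. ?f (?Z 1 \<omega>))"
      using \<phi>_int[of 1] by (rule Bochner_Integration.integrable_cong[THEN iffD1, rotated 2]) (auto simp: X_eq)
    have mean: "expectation (\<lambda>\<omega>. ?f (?Z 1 \<omega>)) = c"
      unfolding \<phi>_mean[of 1, symmetric] by (rule Bochner_Integration.integral_cong) (auto simp: X_eq)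
    have "AE \<omega> in M. (\<lambda>n. (\<Sum>i=1..n. ?f (?Z (int i) \<omega>)) / real n) \<longlonglongrightarrow> c"
      using stationary_ergodic_average[OF st er Z_meas f int] unfolding mean .
    then show ?thesis
      by (rule AE_mp) (intro AE_I2 impI, simp add: X_eq)
  qed
  \<comment> \<open>If c were 0, \<open>X 1\<close> would almost surely be a root of
    \<open>x\<^sup>2 = c0\<close>, but a continuous distribution function gives no mass to
    \<open>sqrt c0\<close> or \<open>- sqrt c0\<close>.\<close>
  have c_pos: "0 < c"
  proof (rule ccontr)
    assume "\<not> 0 < c"
    moreover have "0 \<le> c" unfolding c_def by (intro integral_nonneg_AE) (auto simp: \<phi>_def)
    ultimately have "(\<integral>x. \<phi> x \<partial>\<mu>) = 0" by (simp add: c_def)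
    then have "AE x in \<mu>. \<phi> x = 0"
      by (subst (asm) integral_nonneg_eq_0_iff_AE[OF \<mu>.quantile_transform(1)[OF \<phi>_meas q_int]])
         (auto simp: \<phi>_def)
    moreover have "AE x in \<mu>. x \<noteq> a" for a
    proof -
      have "isCont (cdf \<mu>) a" unfolding cdf using contF by (simp add: continuous_on_eq_continuous_at)
      then have "measure \<mu> {a} = 0" by (simp add: \<mu>.isCont_cdf)
      then have "AE x in \<mu>. x \<notin> {a}" by (subst (asm) \<mu>.prob_eq_0) auto
      then show ?thesis by simp
    qed
    from this[of "sqrt c0"] this[of "- sqrt c0"] have "AE x in \<mu>. x \<noteq> sqrt c0 \<and> x \<noteq> - sqrt c0"
      by eventually_elim simp
    ultimately have "AE x in \<mu>. False"
    proof eventually_elim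
      case (elim x)
      then have "x\<^sup>2 = c0" by (simp add: \<phi>_def)
      then have "\<bar>x\<bar> = sqrt c0" by (metis real_sqrt_abs)
      then show ?case using elim(2) by auto
    qed
    then show False by simp
  qed
  have avg_h: "\<phi> (X (int i) \<omega>) = \<bar>(X (int i) \<omega>)\<^sup>2 - c0\<bar> powr p" for i \<omega> by (simp add: \<phi>_def)
  \<comment> \<open>\<open>indep_var\<close> takes both variables in one type, so the path of
    \<open>X\<close> in \<open>XY_indep\<close> is indexed by natural numbers through the coercion
    \<open>int\<close>; that path is the \<open>U\<close> given here.\<close>
  interpret W: stable_weighted_sums M p c Y "PiM UNIV (\<lambda>_. borel)" "\<lambda>\<omega> n. X (int n) \<omega>" "\<lambda>i u. (u i)\<^sup>2 - c0"
  proof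
    show "AE \<omega> in M. (\<lambda>n. (\<Sum>i=1..n. \<bar>(X (int i) \<omega>)\<^sup>2 - c0\<bar> powr p) / real n) \<longlonglongrightarrow> c"
      using average unfolding avg_h .
    show "integrable M (\<lambda>\<omega>. \<bar>(X (int n) \<omega>)\<^sup>2 - c0\<bar> powr p)" for n using \<phi>_int[of "int n"] unfolding avg_h .
    show "expectation (\<lambda>\<omega>. \<bar>(X (int n) \<omega>)\<^sup>2 - c0\<bar> powr p) = c" for n using \<phi>_mean[of "int n"] unfolding avg_h .
  qed (use p Y_rv Y_indep Y_char XY_indep in auto)
  have N: "prob_space N" using Mo by (simp add: stable_motion_def)
  have Z_borel[measurable]: "Z \<in> borel_measurable N" using Z by (simp add: stable_integral_def)
  let ?M' = "distr N borel Z"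
  have M': "real_distribution ?M'" by (rule prob_space.real_distribution_distr[OF N Z_borel])
  have char: "char ?M' t = complex_of_real (exp (- (\<bar>t\<bar> powr p * c)))" for t
    unfolding c_g
    by (rule char_stable_integral[OF Mo _ g_borel _ g_int]) (use Z p in \<open>simp_all add: g_def[abs_def] c0_def\<close>)
  have cdf': "cdf ?M' x = measure N {\<omega>\<in>space N. Z \<omega> \<le> x}" for x
    unfolding cdf_def by (subst measure_distr) (auto simp: vimage_def Int_def conj_commute)
  have ind: "indicator {\<omega>'. W.norm_sum n \<omega>' \<le> x} \<omega> = indicator {..x} (W.norm_sum n \<omega>)" for n x \<omega>
    by (simp add: indicator_def)
  show ?thesis
    unfolding c0_def[symmetric] W.norm_sum_def[symmetric] cdf'[symmetric] ind
    using W.weak_and_almost_sure_limit[OF M' char c_pos] by blast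
qed

end
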